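(* Let $\alpha\in(0,2)$ and $F:\Omega^X\to\mathbb R$ be such that $$|D_yF(\omega)|\le c\,|y|,\qquad P(d\omega)\otimes\nu(dy)\text{-a.e.},$$ with $c>0$. Then $$P(F-m(F)\ge x)\le\sigma(S^{n-1})\left(\frac32e^2+\frac1\alpha\right)\frac{(4c)^\alpha}{x^\alpha}$$ for all $$x\ge4c\,\sigma(S^{n-1})^{1/\alpha}\left(\left(\frac32\Big(1+\frac4{2-\alpha}\log\frac2{2-\alpha}\Big)\log\Big(1+\frac8{2-\alpha}\log\frac2{2-\alpha}\Big)\right)\vee\frac4\alpha\vee(6e^2)\right)^{1/\alpha}.$$
   Context: $X=\mathbb R^n$ with the Euclidean norm $|\cdot|$, equipped with the $\alpha$-stable Lévy measure $\nu(B)=\int_{S^{n-1}}\sigma(d\xi)\int_0^\infty\mathbf 1_B(r\xi)\,r^{-1-\alpha}\,dr$, $B\in\mathcal B(\mathbb R^n)$, where $\sigma$ is a finite positive measure on the unit sphere $S^{n-1}$ of $\mathbb R^n$. $\Omega^X$ is the space of configurations on $X$ (locally finite, away from $0$, sets of distinct points), $P$ is the Poisson measure on $\Omega^X$ with intensity $\nu$, and $D_yF(\omega)=F(\omega\cup\{y\})-F(\omega)$. $m(F)$ denotes a median of $F$: $P(F\ge m(F))\ge1/2$ and $P(F\le m(F))\ge1/2$. $u\vee v=\max(u,v)$. *)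

theory Defs
  imports "HOL-Probability.Probability"
begin

(* Configurations are locally finite in the punctured space: a Levy measure may give infinite
   mass to every neighbourhood of 0, so points may accumulate there (and only there). *)
definition configurations :: "'a::euclidean_space set set" where
  "configurations = {\<omega>. 0 \<notin> \<omega> \<and> (\<forall>K. compact K \<and> 0 \<notin> K \<longrightarrow> finite (\<omega> \<inter> K))}"

(* The configuration as a point measure: the value at B is the number, possibly infinite,
   of points of the configuration in B. *)
definition num_points :: "'a set \<Rightarrow> 'a set \<Rightarrow> ennreal" where
  "num_points B \<omega> = emeasure (count_space UNIV) (\<omega> \<inter> B)"

definition configuration_space :: "'a::euclidean_space set measure" where
  "configuration_space = sigma configurations
     {num_points B -` A \<inter> configurations | A B. A \<in> sets borel \<and> B \<in> sets borel}"

(* The case of infinite intensity of B is not listed separately: for sigma-finite intensity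
   it follows from the other clauses. *)
definition poisson_measure ::
    "'a::euclidean_space measure \<Rightarrow> 'a set measure \<Rightarrow> bool" where
  "poisson_measure \<nu> P \<longleftrightarrow>
     prob_space P \<and>
     space P = configurations \<and>
     sets P = sets configuration_space \<and>
     (\<forall>B\<in>sets borel. emeasure \<nu> B < \<infinity> \<longrightarrow>
        (\<forall>k. measure P {\<omega> \<in> space P. num_points B \<omega> = of_nat k}
               = exp (- measure \<nu> B) * measure \<nu> B ^ k / fact k)) \<and>
     (\<forall>(I::nat set) B. finite I \<longrightarrow> disjoint_family_on B I \<longrightarrow> (\<forall>i\<in>I. B i \<in> sets borel) \<longrightarrow>
        prob_space.indep_vars P (\<lambda>_. borel) (\<lambda>i. num_points (B i)) I)"

definition stable_levy_measure ::
    "real \<Rightarrow> 'a::euclidean_space measure \<Rightarrow> 'a measure" where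
  "stable_levy_measure \<alpha> \<sigma> = measure_of UNIV (sets borel)
     (\<lambda>B. \<integral>\<^sup>+\<xi>. (\<integral>\<^sup>+r\<in>{0<..}. indicator B (r *\<^sub>R \<xi>) * ennreal (r powr (-1 - \<alpha>)) \<partial>lborel) \<partial>\<sigma>)"

lemma sets_stable_levy_measure [simp]:
  "sets (stable_levy_measure \<alpha> \<sigma>) = sets borel"
  unfolding stable_levy_measure_def using sets.sets_measure_of_eq[of borel] by simp

lemma space_stable_levy_measure [simp]: "space (stable_levy_measure \<alpha> \<sigma>) = UNIV"
  unfolding stable_levy_measure_def using sets.space_measure_of_eq[of borel] by simp

lemma emeasure_stable_levy_measure:
  fixes \<sigma> :: "'a::euclidean_space measure"
  assumes \<sigma>: "sets \<sigma> = sets (restrict_space borel (sphere 0 1))"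
    and B: "B \<in> sets borel"
  shows "emeasure (stable_levy_measure \<alpha> \<sigma>) B =
    (\<integral>\<^sup>+\<xi>. (\<integral>\<^sup>+r\<in>{0<..}. indicator B (r *\<^sub>R \<xi>) * ennreal (r powr (-1 - \<alpha>)) \<partial>lborel) \<partial>\<sigma>)"
proof -
  have "(\<lambda>\<xi>. \<xi>) \<in> borel_measurable (restrict_space borel (sphere (0::'a) 1))"
    by (rule measurable_restrict_space1) simp
  then have id: "(\<lambda>\<xi>. \<xi>) \<in> borel_measurable \<sigma>"
    unfolding measurable_cong_sets[OF \<sigma> refl] .
  let ?g = "\<lambda>B \<xi> r. indicator B (r *\<^sub>R \<xi>) * ennreal (r powr (-1 - \<alpha>)) * indicator {0<..} r"
  let ?\<mu> = "\<lambda>B. \<integral>\<^sup>+\<xi>. (\<integral>\<^sup>+r. ?g B \<xi> r \<partial>lborel) \<partial>\<sigma>"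
  have g2: "(\<lambda>p. ?g A (fst p) (snd p)) \<in> borel_measurable (\<sigma> \<Otimes>\<^sub>M lborel)"
    if A: "A \<in> sets borel" for A :: "'a set"
  proof -
    have snd: "snd \<in> borel_measurable (\<sigma> \<Otimes>\<^sub>M lborel)"
      using measurable_snd[of \<sigma> lborel] by simp
    have "(\<lambda>p. snd p *\<^sub>R fst p) \<in> borel_measurable (\<sigma> \<Otimes>\<^sub>M lborel)"
      by (intro borel_measurable_scaleR snd measurable_compose[OF measurable_fst id])
    then have 1: "(\<lambda>p. indicator A (snd p *\<^sub>R fst p) :: ennreal) \<in> borel_measurable (\<sigma> \<Otimes>\<^sub>M lborel)"
      by (rule measurable_compose) (rule borel_measurable_indicator[OF A])
    have "(\<lambda>r. ennreal (r powr (-1 - \<alpha>)) * indicator {0<..} r) \<in> borel_measurable borel"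
      by measurable
    from borel_measurable_times_ennreal[OF 1 measurable_compose[OF snd this]] show ?thesis
      by (simp add: mult.assoc)
  qed
  have g1: "?g A \<xi> \<in> borel_measurable lborel"
    if A: "A \<in> sets borel" and \<xi>: "\<xi> \<in> space \<sigma>" for A :: "'a set" and \<xi> :: 'a
    using measurable_Pair2[OF g2[OF A] \<xi>] by simp
  have g0: "(\<lambda>\<xi>. \<integral>\<^sup>+r. ?g A \<xi> r \<partial>lborel) \<in> borel_measurable \<sigma>"
    if "A \<in> sets borel" for A :: "'a set"
    using lborel.borel_measurable_nn_integral_fst[OF g2[OF that]] by simp
  have "countably_additive (sets borel) ?\<mu>"
  proof (rule countably_additiveI)
    fix A :: "nat \<Rightarrow> 'a set"
    assume A: "range A \<subseteq> sets borel" "disjoint_family A"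
    then have Ai: "A i \<in> sets borel" for i by auto
    have ind: "?g (\<Union> (range A)) \<xi> r = (\<Sum>i. ?g (A i) \<xi> r)" for \<xi> r
      unfolding ennreal_suminf_multc suminf_indicator[OF A(2)] ..
    have "(\<Sum>i. ?\<mu> (A i)) = (\<integral>\<^sup>+\<xi>. (\<Sum>i. \<integral>\<^sup>+r. ?g (A i) \<xi> r \<partial>lborel) \<partial>\<sigma>)"
      by (rule nn_integral_suminf[symmetric]) (rule g0[OF Ai])
    also have "\<dots> = ?\<mu> (\<Union> (range A))"
      unfolding ind by (rule nn_integral_cong, rule nn_integral_suminf[symmetric]) (rule g1[OF Ai])
    finally show "(\<Sum>i. ?\<mu> (A i)) = ?\<mu> (\<Union> (range A))" .
  qed
  moreover have "positive (sets borel) ?\<mu>"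
    by (simp add: positive_def)
  ultimately show ?thesis
    using B unfolding stable_levy_measure_def
    by (intro emeasure_measure_of_sigma) (use sets.sigma_algebra_axioms[of borel] in simp_all)
qed

definition difference :: "'a \<Rightarrow> ('a set \<Rightarrow> real) \<Rightarrow> 'a set \<Rightarrow> real" where
  "difference y F \<omega> = F (\<omega> \<union> {y}) - F \<omega>"

definition is_median :: "'a measure \<Rightarrow> ('a \<Rightarrow> real) \<Rightarrow> real \<Rightarrow> bool" where
  "is_median P F m \<longleftrightarrow>
     measure P {\<omega> \<in> space P. F \<omega> \<ge> m} \<ge> 1/2 \<and> measure P {\<omega> \<in> space P. F \<omega> \<le> m} \<ge> 1/2"

end

theory Submission
  imports Defs "HOL-Real_Asymp.Real_Asymp"
begin

text \<open>Let \<open>R = x / (4c)\<close> and let \<open>s = \<sigma>(S\<^sup>n\<^sup>-\<^sup>1) R\<^sup>-\<^sup>\<alpha>\<close>. Removing the points of norm greater than \<open>R\<close> changes the configuration with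
  probability at most \<open>s/\<alpha>\<close>. For the truncated functional, clamped to be bounded, resample the
  points in thin shells \<open>R q\<^sup>i\<^sup>+\<^sup>1 < |y| \<le> R q\<^sup>i\<close> one shell at a time. A shell of mass \<open>l\<close> contains
  one point with probability about \<open>l\<close> and more with probability at most \<open>l\<^sup>2\<close>, so each step costs
  a factor \<open>exp (l (exp (t c R q\<^sup>i) - 1 - t c R q\<^sup>i) + O(l\<^sup>2))\<close> in the exponential moment. Letting
  \<open>q\<close> tend to 1, and then the inner radius to 0 with the zero-one law, gives with \<open>t = u / (cR)\<close>
  a deviation probability of at most \<open>exp (s (u\<^sup>2 / (2 (2 - \<alpha>)) + exp u) - 2u)\<close> for exceeding the mean
  by \<open>2cR\<close>. The choice \<open>u = - ln s\<close> turns this into \<open>3e\<^sup>2s/2\<close>, because the lower bound on \<open>x\<close> forces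
  \<open>- s ln s \<le> 2 (2 - \<alpha>)\<close>. The same bounds, with the other terms of the maximum, show that the mean
  exceeds the median by at most \<open>2cR\<close>.\<close>

subsection \<open>Configurations and their counts\<close>

text \<open>Nothing makes \<open>F\<close> integrable and its Lipschitz bound holds only almost
  everywhere, so the argument works with bounded functionals and averages that are explicit at every
  configuration. Averaging over an independent copy of the points in a region is conditioning on the
  points outside it, and averaging over more and more shells leads from the functional to its mean.
  The clamping bound \<open>M\<close> enters a shell only through a factor close to 1 and a term of
  order (shell mass)^2. There are N shells of mass O(1/N), so both effects vanish in the limit and
  the final estimate is free of \<open>M\<close>. The limiting exponent is s times the integral over
  (0,1) of (exp(ux) - 1 - ux) x^(-1-\<alpha>). Only the quadratic Taylor term may carry
  1/(2-\<alpha>), which blows up as \<alpha> tends to 2; the cubic tail integrates to at most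
  exp(u)/(3-\<alpha>), hence at most exp(u). The factor 4 is two times two: from x = 4cR, one half
  covers the gap between mean and median and the other half the deviation above the mean. The terms
  4/\<alpha> and 6e^2 of the maximum make s/\<alpha> and 3e^2 s/2 at most 1/4 each, so together they
  stay within the 1/2 that a median guarantees.\<close>

lemma num_points_Un_disjoint:
  "A \<inter> B = {} \<Longrightarrow> num_points (A \<union> B) \<omega> = num_points A \<omega> + num_points B \<omega>"
  unfolding num_points_def Int_Un_distrib by (subst plus_emeasure) auto

lemma num_points_Int: "num_points B (\<omega> \<inter> A) = num_points (A \<inter> B) \<omega>"
  by (simp add: num_points_def Int_assoc)

lemma num_points_eq_0_iff: "num_points B \<omega> = 0 \<longleftrightarrow> \<omega> \<inter> B = {}"
  by (simp add: num_points_def emeasure_count_space_eq_0)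

lemma num_points_eq_1_iff: "num_points B \<omega> = 1 \<longleftrightarrow> (\<exists>y. \<omega> \<inter> B = {y})"
proof -
  have "num_points B \<omega> = 1 \<longleftrightarrow> card (\<omega> \<inter> B) = 1"
    by (cases "finite (\<omega> \<inter> B)") (auto simp: num_points_def emeasure_count_space)
  then show ?thesis
    by (simp add: card_1_singleton_iff)
qed

lemma num_points_sum:
  assumes "finite I" "disjoint_family_on C I"
  shows "num_points (\<Union>i\<in>I. C i) \<omega> = (\<Sum>i\<in>I. num_points (C i) \<omega>)"
  using assms
proof (induction I)
  case empty
  show ?case by (simp add: num_points_eq_0_iff)
next
  case (insert i I)
  then show ?case
    by (simp add: num_points_Un_disjoint disjoint_family_on_insert)
qed

lemma num_points_SUP:
  assumes "incseq C"
  shows "num_points (\<Union>i. C i) \<omega> = (SUP i. num_points (C i) \<omega>)"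
  unfolding num_points_def Int_UN_distrib
  by (rule SUP_emeasure_incseq[symmetric]) (use assms in \<open>auto simp: incseq_def\<close>)

lemma space_configuration_space [simp]: "space configuration_space = configurations"
  unfolding configuration_space_def by (rule space_measure_of) auto

lemma configurations_mono: "\<omega> \<in> configurations \<Longrightarrow> \<omega>' \<subseteq> \<omega> \<Longrightarrow> \<omega>' \<in> configurations"
  unfolding configurations_def by (auto intro: finite_subset[OF Int_mono])

lemma configurations_Un:
  "\<omega> \<in> configurations \<Longrightarrow> \<omega>' \<in> configurations \<Longrightarrow> \<omega> \<union> \<omega>' \<in> configurations"
  unfolding configurations_def by (auto simp: Int_Un_distrib2)

lemma configurations_insert:
  "\<omega> \<in> configurations \<Longrightarrow> y \<noteq> 0 \<Longrightarrow> insert y \<omega> \<in> configurations"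
  unfolding configurations_def by (auto simp: Int_insert_left)

lemma measurable_num_points [measurable]:
  assumes "B \<in> sets borel"
  shows "num_points B \<in> borel_measurable configuration_space"
proof (rule measurableI)
  fix A :: "ennreal set" assume "A \<in> sets borel"
  then show "num_points B -` A \<inter> space configuration_space \<in> sets configuration_space"
    unfolding space_configuration_space unfolding configuration_space_def
    using assms by (subst sets_measure_of) auto
qed auto

lemma measurable_configuration_spaceI:
  fixes f :: "'b \<Rightarrow> 'a::euclidean_space set"
  assumes "\<And>x. x \<in> space N \<Longrightarrow> f x \<in> configurations"
    and "\<And>B. B \<in> sets borel \<Longrightarrow> (\<lambda>x. num_points B (f x)) \<in> borel_measurable N"
  shows "f \<in> measurable N configuration_space"
  unfolding configuration_space_def
proof (rule measurable_measure_of)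
  show "{num_points B -` A \<inter> configurations |A B. A \<in> sets borel \<and> B \<in> sets borel} \<subseteq> Pow configurations"
    by auto
  show "f \<in> space N \<rightarrow> configurations" using assms(1) by auto
  fix Y :: "'a set set" assume "Y \<in> {num_points B -` A \<inter> configurations |A B. A \<in> sets borel \<and> B \<in> sets borel}"
  then obtain A B where AB: "A \<in> sets borel" "B \<in> sets borel" and Y: "Y = num_points B -` A \<inter> configurations"
    by auto
  have "f -` Y \<inter> space N = (\<lambda>x. num_points B (f x)) -` A \<inter> space N"
    using assms(1) by (auto simp: Y)
  then show "f -` Y \<inter> space N \<in> sets N"
    using measurable_sets[OF assms(2)[OF AB(2)] AB(1)] by simp
qed

text \<open>For independent \<open>\<omega>\<close> and \<open>\<omega>'\<close>, integrating out
  \<open>\<omega>'\<close> alone gives conditioning on the points outside \<open>U\<close>, with a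
  version that is defined at every configuration.\<close>

definition resample :: "'a set \<Rightarrow> 'a set \<Rightarrow> 'a set \<Rightarrow> 'a set" where
  "resample U \<omega> \<omega>' = (\<omega> - U) \<union> (\<omega>' \<inter> U)"

text \<open>Leaves the configuration unchanged at \<open>y = 0\<close>, where inserting the point would leave the
  space of configurations.\<close>
definition add_point :: "'a::zero \<Rightarrow> 'a set \<Rightarrow> 'a set" where
  "add_point y \<omega> = (if y = 0 then \<omega> else insert y \<omega>)"

lemma num_points_resample:
  "num_points B (resample U \<omega> \<omega>') = num_points (B - U) \<omega> + num_points (B \<inter> U) \<omega>'"
proof -
  have "resample U \<omega> \<omega>' \<inter> B = (\<omega> \<inter> (B - U)) \<union> (\<omega>' \<inter> (B \<inter> U))"
    by (auto simp: resample_def)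
  then show ?thesis
    unfolding num_points_def by (simp only:) (subst plus_emeasure, auto)
qed

lemma resample_in_configurations:
  "\<omega> \<in> configurations \<Longrightarrow> \<omega>' \<in> configurations \<Longrightarrow> resample U \<omega> \<omega>' \<in> configurations"
  unfolding resample_def by (intro configurations_Un) (auto elim: configurations_mono)

lemma measurable_resample:
  assumes U: "U \<in> sets borel"
  shows "(\<lambda>p. resample U (fst p) (snd p))
    \<in> measurable (configuration_space \<Otimes>\<^sub>M configuration_space) configuration_space"
proof (rule measurable_configuration_spaceI)
  fix B :: "'a set" assume [measurable]: "B \<in> sets borel"
  note U[measurable]
  show "(\<lambda>p. num_points B (resample U (fst p) (snd p)))
      \<in> borel_measurable (configuration_space \<Otimes>\<^sub>M configuration_space)"
    unfolding num_points_resample by measurable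
qed (auto simp: space_pair_measure intro: resample_in_configurations)

lemma add_point_in_configurations:
  "\<omega> \<in> configurations \<Longrightarrow> add_point y \<omega> \<in> configurations"
  by (auto simp: add_point_def intro: configurations_insert)

lemma num_points_add_point:
  "num_points B (add_point y \<omega>) =
    num_points B \<omega> + indicator (B - {0}) y * (if y \<in> \<omega> then 0 else 1)"
proof (cases "y \<in> B - {0} \<and> y \<notin> \<omega>")
  case True
  then have "add_point y \<omega> \<inter> B = (\<omega> \<inter> B) \<union> {y}"
    by (auto simp: add_point_def)
  moreover have "emeasure (count_space UNIV) ((\<omega> \<inter> B) \<union> {y})
      = emeasure (count_space UNIV) (\<omega> \<inter> B) + emeasure (count_space UNIV) {y}"
    using True by (intro plus_emeasure[symmetric]) auto
  ultimately show ?thesis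
    using True by (simp add: num_points_def)
next
  case False
  then have "add_point y \<omega> \<inter> B = \<omega> \<inter> B"
    by (auto simp: add_point_def)
  moreover from False have "indicator (B - {0}) y * (if y \<in> \<omega> then 0 else 1) = (0::ennreal)"
    by (auto simp: indicator_def)
  ultimately show ?thesis
    by (simp add: num_points_def)
qed

text \<open>The closed ball of radius |y|/2 about \<open>y\<close> is compact and avoids 0, so it
  contains only finitely many points of the configuration.\<close>

lemma configuration_closed_off_0:
  assumes "\<omega> \<in> configurations" "y \<noteq> 0" "y \<notin> \<omega>"
  obtains V where "open V" "y \<in> V" "\<omega> \<inter> V = {}"
proof
  define K where "K = cball y (norm y / 2)"
  have "0 \<notin> K" using assms(2) by (auto simp: K_def)
  then have fin: "finite (\<omega> \<inter> K)"
    using assms(1) by (auto simp: configurations_def K_def)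
  let ?V = "ball y (norm y / 2) - (\<omega> \<inter> K)"
  show "open ?V" using fin by (intro open_Diff finite_imp_closed) auto
  show "y \<in> ?V" using assms by auto
  show "\<omega> \<inter> ?V = {}" by (auto simp: K_def)
qed

text \<open>A point off 0 is missing from a configuration exactly when some basic open set around it
  contains no point of the configuration. A countable basis turns this into a countable union of
  events about counts. Inserting \<open>y\<close> raises a count only if \<open>y\<close> is new, so
  \<open>measurable_add_point\<close> rests on this event.\<close>

lemma sets_mem_configuration:
  "{p \<in> space (configuration_space \<Otimes>\<^sub>M (borel :: 'a::euclidean_space measure)).
     snd p \<noteq> 0 \<and> snd p \<notin> fst p} \<in> sets (configuration_space \<Otimes>\<^sub>M borel)"
proof -
  obtain \<B> :: "'a set set" where \<B>: "countable \<B>" "topological_basis \<B>"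
    using ex_countable_basis by auto
  have [measurable]: "V \<in> sets borel" if "V \<in> \<B>" for V
    using topological_basis_open[OF \<B>(2) that] by auto
  have "{p \<in> space (configuration_space \<Otimes>\<^sub>M borel). snd p \<noteq> (0::'a) \<and> snd p \<notin> fst p} =
    (\<Union>V\<in>\<B>. {p \<in> space (configuration_space \<Otimes>\<^sub>M borel).
       snd p \<noteq> 0 \<and> snd p \<in> V \<and> num_points V (fst p) = 0})" (is "?L = ?R")
  proof (intro equalityI subsetI)
    fix p assume p: "p \<in> ?L"
    then have "fst p \<in> configurations" by (auto simp: space_pair_measure)
    with p obtain V where V: "open V" "snd p \<in> V" "fst p \<inter> V = {}"
      using configuration_closed_off_0[of "fst p" "snd p"] by auto
    then obtain W where "W \<in> \<B>" "snd p \<in> W" "W \<subseteq> V"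
      using topological_basisE[OF \<B>(2)] by metis
    with p V show "p \<in> ?R" by (auto simp: num_points_eq_0_iff)
  next
    fix p assume "p \<in> ?R"
    then show "p \<in> ?L" by (auto simp: num_points_eq_0_iff)
  qed
  also have "\<dots> \<in> sets (configuration_space \<Otimes>\<^sub>M borel)"
    by (intro sets.countable_UN'' \<B>(1)) measurable
  finally show ?thesis .
qed

lemma measurable_add_point:
  "(\<lambda>p. add_point (snd p) (fst p))
    \<in> measurable (configuration_space \<Otimes>\<^sub>M (borel :: 'a::euclidean_space measure)) configuration_space"
proof (rule measurable_configuration_spaceI)
  fix B :: "'a set" assume B[measurable]: "B \<in> sets borel"
  let ?N = "{p \<in> space (configuration_space \<Otimes>\<^sub>M borel). snd p \<noteq> (0::'a) \<and> snd p \<notin> fst p}"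
  note sets_mem_configuration[where 'a='a, measurable]
  have "(\<lambda>p. num_points B (fst p) + indicator B (snd p) * indicator ?N p)
      \<in> borel_measurable (configuration_space \<Otimes>\<^sub>M borel)"
    by measurable
  also have "?this \<longleftrightarrow> (\<lambda>p. num_points B (add_point (snd p) (fst p)))
      \<in> borel_measurable (configuration_space \<Otimes>\<^sub>M borel)"
    by (rule measurable_cong) (auto simp: num_points_add_point indicator_def)
  finally show "\<dots>" .
qed (auto simp: space_pair_measure intro: add_point_in_configurations)

subsection \<open>Independence and resampling\<close>

text \<open>Minimality of the \<sigma>-algebra generated by the counts. Applied to the
  \<sigma>-algebra of a candidate pi-system, it shows that the pi-system generates.\<close>

lemma sets_configuration_space_subset:
  fixes N :: "'a::euclidean_space set measure"
  assumes "space N = configurations"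
    and "\<And>B. B \<in> sets borel \<Longrightarrow> num_points B \<in> borel_measurable N"
  shows "sets configuration_space \<subseteq> sets N"
proof
  fix X :: "'a set set" assume X: "X \<in> sets configuration_space"
  have "(\<lambda>\<omega>. \<omega>) \<in> measurable N configuration_space"
    by (rule measurable_configuration_spaceI) (use assms in auto)
  from measurable_sets[OF this X] show "X \<in> sets N"
    using sets.sets_into_space[OF X] assms(1) by (simp add: Int_absorb2)
qed

locale poisson_process =
  fixes \<nu> :: "'a::euclidean_space measure" and P :: "'a set measure"
  assumes poisson: "poisson_measure \<nu> P"
    and sets_intensity: "sets \<nu> = sets borel"
    and sigma_finite_intensity: "sigma_finite_measure \<nu>"
begin

sublocale prob_space P
  using poisson by (simp add: poisson_measure_def)

lemma space_P [simp]: "space P = configurations"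
  using poisson by (simp add: poisson_measure_def)

lemma sets_P [measurable_cong]: "sets P = sets configuration_space"
  using poisson by (simp add: poisson_measure_def)

lemmas sets_intensity_cong [measurable_cong] = sets_intensity

lemma prob_num_points:
  assumes "B \<in> sets borel" "emeasure \<nu> B < \<infinity>"
  shows "prob {\<omega> \<in> configurations. num_points B \<omega> = of_nat k}
    = exp (- measure \<nu> B) * measure \<nu> B ^ k / fact k"
  using poisson assms by (simp add: poisson_measure_def)

lemma indep_num_points:
  fixes I :: "nat set"
  assumes "finite I" "disjoint_family_on B I" "\<And>i. i \<in> I \<Longrightarrow> B i \<in> sets borel"
  shows "indep_vars (\<lambda>_. borel) (\<lambda>i. num_points (B i)) I"
  using poisson assms by (simp add: poisson_measure_def)

text \<open>The atoms of the algebra generated by the given sets are disjoint, and the counts of the given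
  sets inside \<open>U\<close> and outside \<open>U\<close> are sums over disjoint families of atoms.\<close>
lemma prob_counts_inside_outside:
  fixes \<F> \<G> :: "('a set \<times> ennreal set) set"
  assumes U: "U \<in> sets borel"
    and \<F>: "finite \<F>" "\<F> \<subseteq> sets borel \<times> sets borel" "\<And>B A. (B, A) \<in> \<F> \<Longrightarrow> B \<subseteq> U"
    and \<G>: "finite \<G>" "\<G> \<subseteq> sets borel \<times> sets borel" "\<And>B A. (B, A) \<in> \<G> \<Longrightarrow> B \<inter> U = {}"
  shows "prob {\<omega> \<in> configurations. (\<forall>(B, A)\<in>\<F>. num_points B \<omega> \<in> A) \<and> (\<forall>(B, A)\<in>\<G>. num_points B \<omega> \<in> A)}
    = prob {\<omega> \<in> configurations. \<forall>(B, A)\<in>\<F>. num_points B \<omega> \<in> A} *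
      prob {\<omega> \<in> configurations. \<forall>(B, A)\<in>\<G>. num_points B \<omega> \<in> A}"
proof -
  \<comment> \<open>Including \<open>U\<close> among the sets forces every atom to lie entirely
    inside or entirely outside \<open>U\<close>.\<close>
  define \<B> where "\<B> = insert U (fst ` (\<F> \<union> \<G>))"
  have fin: "finite \<B>" using \<F>(1) \<G>(1) by (simp add: \<B>_def)
  have borel: "B \<in> sets borel" if "B \<in> \<B>" for B
    using that U \<F>(2) \<G>(2) by (auto simp: \<B>_def)
  \<comment> \<open>The independence clause of \<open>poisson_measure\<close> is indexed by
    naturals, so the membership patterns have to be enumerated. Patterns that no point realizes give
    empty atoms, which are harmless.\<close>
  obtain h where h: "bij_betw h {..<card (Pow \<B>)} (Pow \<B>)"
    using ex_bij_betw_nat_finite[of "Pow \<B>"] fin by (auto simp: atLeast0LessThan)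
  define n where "n = card (Pow \<B>)"
  define D where "D i = {y. \<forall>B\<in>\<B>. y \<in> B \<longleftrightarrow> B \<in> h i}" for i
  have D_borel: "D i \<in> sets borel" for i
  proof -
    have "{y \<in> space borel. \<forall>B\<in>\<B>. y \<in> B \<longleftrightarrow> B \<in> h i} \<in> sets borel"
    proof (rule sets.sets_Collect_finite_All'[OF _ fin])
      fix B assume "B \<in> \<B>"
      then have [measurable]: "B \<in> sets borel" by (rule borel)
      show "{y \<in> space borel. (y \<in> B) = (B \<in> h i)} \<in> sets borel" by measurable
    qed (auto simp: \<B>_def)
    then show ?thesis by (simp add: D_def)
  qed
  have D_disj: "disjoint_family_on D {..<n}"
  unfolding disjoint_family_on_def
  proof (intro ballI impI)
    fix i j assume ij: "i \<in> {..<n}" "j \<in> {..<n}" "i \<noteq> j"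
    then have "h i \<noteq> h j" "h i \<subseteq> \<B>" "h j \<subseteq> \<B>"
      using h unfolding n_def bij_betw_def inj_on_def by auto
    then obtain B where "B \<in> \<B>" "(B \<in> h i) \<noteq> (B \<in> h j)" by auto
    then show "D i \<inter> D j = {}" by (auto simp: D_def)
  qed
  have D_ex: "\<exists>i<n. y \<in> D i \<and> h i = {B\<in>\<B>. y \<in> B}" for y
  proof -
    have "h ` {..<n} = Pow \<B>" using h by (simp add: n_def bij_betw_def)
    then have "{B\<in>\<B>. y \<in> B} \<in> h ` {..<n}" by blast
    then obtain i where i: "i < n" "{B\<in>\<B>. y \<in> B} = h i" by blast
    then have "y \<in> D i" by (simp add: D_def i(2)[symmetric])
    with i show ?thesis by metis
  qed
  \<comment> \<open>\<open>K True\<close> indexes the atoms inside \<open>U\<close> and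
    \<open>K False\<close> those outside. The two groups are disjoint, so the two vectors of counts
    over them are independent.\<close>
  define K where "K b = {i. i < n \<and> (U \<in> h i \<longleftrightarrow> b)}" for b
  have finK: "finite (K b)" for b by (simp add: K_def)
  have N_eq: "num_points B \<omega> = (\<Sum>i\<in>{i\<in>K b. B \<in> h i}. num_points (D i) \<omega>)"
    if B: "B \<in> \<B>" and sub: "\<And>y. y \<in> B \<Longrightarrow> y \<in> U \<longleftrightarrow> b" for B b \<omega>
  proof -
    have "B = (\<Union>i\<in>{i\<in>K b. B \<in> h i}. D i)"
    proof (intro equalityI subsetI)
      fix y assume y: "y \<in> B"
      obtain i where i: "i < n" "y \<in> D i" "h i = {B\<in>\<B>. y \<in> B}" using D_ex by blast
      moreover have "U \<in> h i \<longleftrightarrow> b" using sub[OF y] by (simp add: i(3) \<B>_def)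
      moreover have "B \<in> h i" using B y by (simp add: i(3))
      ultimately show "y \<in> (\<Union>i\<in>{i\<in>K b. B \<in> h i}. D i)"
        by (intro UN_I[of i]) (simp_all add: K_def)
    next
      fix y assume "y \<in> (\<Union>i\<in>{i\<in>K b. B \<in> h i}. D i)"
      then show "y \<in> B" using B by (auto simp: D_def)
    qed
    then have "num_points B \<omega> = num_points (\<Union>i\<in>{i\<in>K b. B \<in> h i}. D i) \<omega>"
      by (rule arg_cong[where f = "\<lambda>C. num_points C \<omega>"])
    also have "\<dots> = (\<Sum>i\<in>{i\<in>K b. B \<in> h i}. num_points (D i) \<omega>)"
      by (rule num_points_sum) (use finK D_disj in \<open>auto simp: disjoint_family_on_def K_def\<close>)
    finally show ?thesis .
  qed
  define M where "M b = PiM (K b) (\<lambda>_. borel :: ennreal measure)" for b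
  define X where "X b = (\<lambda>\<omega>. restrict (\<lambda>i. num_points (D i) \<omega>) (K b))" for b
  \<comment> \<open>The prescribed events, rewritten as measurable conditions on the vector of atom
    counts.\<close>
  define S where "S b \<H> = {f \<in> space (M b). \<forall>(B, A)\<in>\<H>. (\<Sum>i\<in>{i\<in>K b. B \<in> h i}. f i) \<in> A}"
    for b and \<H> :: "('a set \<times> ennreal set) set"
  have S_sets: "S b \<H> \<in> sets (M b)" if "finite \<H>" "\<H> \<subseteq> sets borel \<times> sets borel" for b \<H>
  proof (cases "\<H> = {}")
    case True then show ?thesis by (simp add: S_def)
  next
    case False
    have "{f \<in> space (M b). \<forall>p\<in>\<H>. (\<Sum>i\<in>{i\<in>K b. fst p \<in> h i}. f i) \<in> snd p} \<in> sets (M b)"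
    proof (rule sets.sets_Collect_finite_All'[OF _ that(1) False])
      fix p assume "p \<in> \<H>"
      then have "snd p \<in> sets borel" using that(2) by auto
      moreover have "(\<lambda>f. \<Sum>i\<in>{i\<in>K b. fst p \<in> h i}. f i) \<in> borel_measurable (M b)"
        unfolding M_def by (intro borel_measurable_sum measurable_component_singleton) auto
      ultimately show "{f \<in> space (M b). (\<Sum>i\<in>{i\<in>K b. fst p \<in> h i}. f i) \<in> snd p} \<in> sets (M b)"
        by measurable
    qed
    then show ?thesis by (simp add: S_def case_prod_beta)
  qed
  have X_S: "X b -` S b \<H> \<inter> space P = {\<omega> \<in> configurations. \<forall>(B, A)\<in>\<H>. num_points B \<omega> \<in> A}"
    if \<H>: "\<And>B A. (B, A) \<in> \<H> \<Longrightarrow> B \<in> \<B> \<and> (\<forall>y\<in>B. y \<in> U \<longleftrightarrow> b)" for b \<H>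
  proof -
    have "(\<Sum>i\<in>{i\<in>K b. B \<in> h i}. X b \<omega> i) = num_points B \<omega>" if "(B, A) \<in> \<H>" for B A \<omega>
      using N_eq[of B b \<omega>] \<H>[OF that] by (simp add: X_def)
    moreover have "X b \<omega> \<in> space (M b)" for \<omega>
      by (simp add: X_def M_def space_PiM)
    ultimately show ?thesis by (auto simp: S_def)
  qed
  have "indep_vars (\<lambda>_. borel) (\<lambda>i. num_points (D i)) {..<n}"
    by (intro indep_num_points D_disj D_borel) auto
  then have ind: "indep_var (M True) (X True) (M False) (X False)"
    unfolding M_def X_def by (rule indep_var_restrict) (auto simp: K_def)
  have F: "B \<in> \<B> \<and> (\<forall>y\<in>B. y \<in> U \<longleftrightarrow> True)" if "(B, A) \<in> \<F>" for B A
  proof -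
    have "B \<in> fst ` (\<F> \<union> \<G>)" using that by (intro image_eqI[of _ _ "(B, A)"]) auto
    with \<F>(3)[OF that] show ?thesis by (auto simp: \<B>_def)
  qed
  have G: "B \<in> \<B> \<and> (\<forall>y\<in>B. y \<in> U \<longleftrightarrow> False)" if "(B, A) \<in> \<G>" for B A
  proof -
    have "B \<in> fst ` (\<F> \<union> \<G>)" using that by (intro image_eqI[of _ _ "(B, A)"]) auto
    with \<G>(3)[OF that] show ?thesis by (auto simp: \<B>_def)
  qed
  have XF: "X True -` S True \<F> \<inter> space P = {\<omega> \<in> configurations. \<forall>(B, A)\<in>\<F>. num_points B \<omega> \<in> A}"
    by (rule X_S) (rule F)
  have XG: "X False -` S False \<G> \<inter> space P = {\<omega> \<in> configurations. \<forall>(B, A)\<in>\<G>. num_points B \<omega> \<in> A}"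
    by (rule X_S) (rule G)
  have "(\<lambda>x. (X True x, X False x)) -` (S True \<F> \<times> S False \<G>) \<inter> space P
    = (X True -` S True \<F> \<inter> space P) \<inter> (X False -` S False \<G> \<inter> space P)" by auto
  also have "\<dots> = {\<omega> \<in> configurations. (\<forall>(B, A)\<in>\<F>. num_points B \<omega> \<in> A) \<and> (\<forall>(B, A)\<in>\<G>. num_points B \<omega> \<in> A)}"
    unfolding XF XG by blast
  finally show ?thesis
    using indep_varD[OF ind S_sets[OF \<F>(1,2)] S_sets[OF \<G>(1,2)]]
    unfolding XF XG by simp
qed

lemma measurable_resample_P:
  assumes "U \<in> sets borel"
  shows "(\<lambda>p. resample U (fst p) (snd p)) \<in> measurable (P \<Otimes>\<^sub>M P) P"
  unfolding measurable_cong_sets[OF sets_pair_measure_cong[OF sets_P sets_P] sets_P]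
  by (rule measurable_resample[OF assms])

lemma sets_counts:
  assumes "finite \<F>" "\<F> \<subseteq> sets borel \<times> sets borel"
  shows "{\<omega> \<in> configurations. \<forall>(B, A)\<in>\<F>. num_points B \<omega> \<in> A} \<in> sets P"
proof (cases "\<F> = {}")
  case True
  then show ?thesis using sets.top[of P] by simp
next
  case False
  have "{\<omega> \<in> space P. \<forall>p\<in>\<F>. num_points (fst p) \<omega> \<in> snd p} \<in> sets P"
  proof (rule sets.sets_Collect_finite_All'[OF _ assms(1) False])
    fix p assume "p \<in> \<F>"
    then have [measurable]: "fst p \<in> sets borel" "snd p \<in> sets borel" using assms(2) by auto
    show "{\<omega> \<in> space P. num_points (fst p) \<omega> \<in> snd p} \<in> sets P" by measurable
  qed
  then show ?thesis by (simp add: case_prod_beta)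
qed

text \<open>Two laws are compared on the pi-system of events fixing the counts of finitely many
  sets, each inside or outside \<open>U\<close>. For the resampled configuration the outside counts
  come from the first factor and the inside counts from the second, so the product measure
  factorizes exactly as \<open>prob_counts_inside_outside\<close> says \<open>P\<close> does. The
  system generates because every count is the sum of its parts inside and outside
  \<open>U\<close>.\<close>

lemma distr_resample:
  assumes U: "U \<in> sets borel"
  shows "distr (P \<Otimes>\<^sub>M P) P (\<lambda>p. resample U (fst p) (snd p)) = P"
proof -
  interpret PP: pair_prob_space P P ..
  define ev :: "('a set \<times> ennreal set) set \<Rightarrow> 'a set set"
    where "ev \<F> = {\<omega> \<in> configurations. \<forall>(B, A)\<in>\<F>. num_points B \<omega> \<in> A}" for \<F>
  define fam :: "('a set \<times> ennreal set) set \<Rightarrow> bool"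
    where "fam \<F> \<longleftrightarrow> finite \<F> \<and> \<F> \<subseteq> sets borel \<times> sets borel \<and> (\<forall>(B, A)\<in>\<F>. B \<subseteq> U \<or> B \<inter> U = {})" for \<F>
  define E where "E = {ev \<F> | \<F>. fam \<F>}"
  have E_Pow: "E \<subseteq> Pow configurations" by (auto simp: E_def ev_def)
  have E_sets: "E \<subseteq> sets P" using sets_counts by (auto simp: E_def ev_def fam_def)
  have stable: "Int_stable E"
  proof (rule Int_stableI)
    fix a b assume "a \<in> E" "b \<in> E"
    then obtain \<F> \<G> where "a = ev \<F>" "b = ev \<G>" "fam \<F>" "fam \<G>" by (auto simp: E_def)
    moreover from this have "ev \<F> \<inter> ev \<G> = ev (\<F> \<union> \<G>)" "fam (\<F> \<union> \<G>)"
      by (auto simp: ev_def fam_def)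
    ultimately show "a \<inter> b \<in> E" by (auto simp: E_def)
  qed
  have gen: "sets P = sigma_sets configurations E"
  proof
    have "sigma_sets (space P) E \<subseteq> sets P" using E_sets by (rule sets.sigma_sets_subset)
    then show "sigma_sets configurations E \<subseteq> sets P" by simp
    have basic: "num_points B \<in> borel_measurable (sigma configurations E)"
      if B: "B \<in> sets borel" "B \<subseteq> U \<or> B \<inter> U = {}" for B
    proof (rule measurableI)
      fix A :: "ennreal set" assume A: "A \<in> sets borel"
      have "ev {(B, A)} \<in> E" unfolding E_def
        using A B by (intro CollectI exI[of _ "{(B, A)}"]) (auto simp: fam_def)
      moreover have "num_points B -` A \<inter> configurations = ev {(B, A)}" by (auto simp: ev_def)
      ultimately show "num_points B -` A \<inter> space (sigma configurations E) \<in> sets (sigma configurations E)"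
        using E_Pow by (simp add: space_measure_of_conv)
    qed auto
    have "sets configuration_space \<subseteq> sets (sigma configurations E)"
    proof (rule sets_configuration_space_subset)
      fix B :: "'a set" assume B: "B \<in> sets borel"
      have "num_points B \<omega> = num_points (B \<inter> U) \<omega> + num_points (B - U) \<omega>" for \<omega>
        using num_points_Un_disjoint[of "B \<inter> U" "B - U" \<omega>] by (simp add: Un_Diff_Int Int_Diff_Un disjoint_iff)
      moreover have "(\<lambda>\<omega>. num_points (B \<inter> U) \<omega> + num_points (B - U) \<omega>) \<in> borel_measurable (sigma configurations E)"
        by (intro borel_measurable_add basic) (use B U in auto)
      ultimately show "num_points B \<in> borel_measurable (sigma configurations E)"
        by (simp cong: measurable_cong)
    qed (simp add: space_measure_of_conv)
    then show "sets P \<subseteq> sigma_sets configurations E"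
      using E_Pow by (simp add: sets_P)
  qed
  show ?thesis
  proof (rule measure_eqI_generator_eq[OF stable E_Pow, where A = "\<lambda>_::nat. configurations"])
    fix X assume "X \<in> E"
    then obtain \<F> where X: "X = ev \<F>" and \<F>: "fam \<F>" by (auto simp: E_def)
    define \<F>1 where "\<F>1 = {p\<in>\<F>. fst p \<subseteq> U}"
    define \<F>2 where "\<F>2 = {p\<in>\<F>. \<not> fst p \<subseteq> U}"
    have f1: "finite \<F>1" "\<F>1 \<subseteq> sets borel \<times> sets borel" "\<And>B A. (B, A) \<in> \<F>1 \<Longrightarrow> B \<subseteq> U"
      using \<F> by (auto simp: \<F>1_def fam_def)
    have f2: "finite \<F>2" "\<F>2 \<subseteq> sets borel \<times> sets borel" "\<And>B A. (B, A) \<in> \<F>2 \<Longrightarrow> B \<inter> U = {}"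
      using \<F> by (auto simp: \<F>2_def fam_def)
    have X_eq: "X = {\<omega> \<in> configurations. (\<forall>(B, A)\<in>\<F>1. num_points B \<omega> \<in> A) \<and> (\<forall>(B, A)\<in>\<F>2. num_points B \<omega> \<in> A)}"
    proof -
      have "\<F> = \<F>1 \<union> \<F>2" by (auto simp: \<F>1_def \<F>2_def)
      then show ?thesis by (simp add: X ev_def ball_Un)
    qed
    have inside: "num_points B (resample U \<omega> \<omega>') = num_points B \<omega>'" if "B \<subseteq> U" for B \<omega> \<omega>'
      using that by (simp add: num_points_resample Diff_eq_empty_iff[THEN iffD2] Int_absorb2 num_points_eq_0_iff[THEN iffD2])
    have outside: "num_points B (resample U \<omega> \<omega>') = num_points B \<omega>" if "B \<inter> U = {}" for B \<omega> \<omega>'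
      using that by (simp add: num_points_resample Diff_triv num_points_eq_0_iff[THEN iffD2])
    have "X \<in> sets P" using \<open>X \<in> E\<close> E_sets by auto
    then have "emeasure (distr (P \<Otimes>\<^sub>M P) P (\<lambda>p. resample U (fst p) (snd p))) X
        = emeasure (P \<Otimes>\<^sub>M P) ((\<lambda>p. resample U (fst p) (snd p)) -` X \<inter> space (P \<Otimes>\<^sub>M P))"
      by (intro emeasure_distr measurable_resample_P U)
    also have "(\<lambda>p. resample U (fst p) (snd p)) -` X \<inter> space (P \<Otimes>\<^sub>M P) = ev \<F>2 \<times> ev \<F>1"
    proof -
      have 1: "(\<forall>(B, A)\<in>\<F>1. num_points B (resample U \<omega> \<omega>') \<in> A) \<longleftrightarrow> (\<forall>(B, A)\<in>\<F>1. num_points B \<omega>' \<in> A)"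
        for \<omega> \<omega>' by (rule ball_cong) (auto simp: inside f1(3))
      have 2: "(\<forall>(B, A)\<in>\<F>2. num_points B (resample U \<omega> \<omega>') \<in> A) \<longleftrightarrow> (\<forall>(B, A)\<in>\<F>2. num_points B \<omega> \<in> A)"
        for \<omega> \<omega>' by (rule ball_cong) (auto simp: outside f2(3))
      have "resample U \<omega> \<omega>' \<in> X \<longleftrightarrow> \<omega> \<in> ev \<F>2 \<and> \<omega>' \<in> ev \<F>1"
        if "\<omega> \<in> configurations" "\<omega>' \<in> configurations" for \<omega> \<omega>'
        using that resample_in_configurations[OF that] by (simp add: X_eq ev_def 1 2 conj_commute)
      then show ?thesis by (auto simp: space_pair_measure ev_def)
    qed
    also have "emeasure (P \<Otimes>\<^sub>M P) (ev \<F>2 \<times> ev \<F>1) = emeasure P (ev \<F>2) * emeasure P (ev \<F>1)"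
      by (rule emeasure_pair_measure_Times) (use sets_counts f1 f2 in \<open>auto simp: ev_def\<close>)
    also have "\<dots> = emeasure P X"
    proof -
      have "prob X = prob (ev \<F>1) * prob (ev \<F>2)"
        unfolding X_eq ev_def by (rule prob_counts_inside_outside[OF U f1 f2])
      then show ?thesis by (simp add: emeasure_eq_measure ennreal_mult' mult.commute)
    qed
    finally show "emeasure (distr (P \<Otimes>\<^sub>M P) P (\<lambda>p. resample U (fst p) (snd p))) X = emeasure P X" .
  next
    have "ev {} \<in> E" by (auto simp: E_def fam_def)
    then show "range (\<lambda>_::nat. configurations) \<subseteq> E" by (auto simp: ev_def)
    interpret D: prob_space "distr (P \<Otimes>\<^sub>M P) P (\<lambda>p. resample U (fst p) (snd p))"
      by (rule PP.prob_space_distr[OF measurable_resample_P[OF U]])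
    show "emeasure (distr (P \<Otimes>\<^sub>M P) P (\<lambda>p. resample U (fst p) (snd p))) configurations \<noteq> \<infinity>"
      using D.emeasure_finite by simp
  qed (use gen in auto)
qed

end

subsection \<open>Exponential moments over thin shells\<close>

lemma exp_remainder_nonneg: "0 \<le> exp u - 1 - u" for u :: real
  using exp_ge_add_one_self[of u] by linarith

text \<open>The remainder has a power series starting at degree 2 with nonnegative coefficients, so
  the comparison holds term by term, whatever the sign of \<open>u\<close>.\<close>

lemma exp_remainder_mono:
  fixes u v :: real
  assumes "\<bar>u\<bar> \<le> v"
  shows "exp u - 1 - u \<le> exp v - 1 - v"
proof -
  have s: "summable (\<lambda>n. inverse (fact (n + 2)) * x ^ (n + 2))" for x :: real
    using summable_exp[of x] by (subst summable_iff_shift)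
  have eq: "exp x - 1 - x = (\<Sum>n. inverse (fact (n + 2)) * x ^ (n + 2))" for x :: real
    using exp_first_two_terms[of x] by (simp add: field_simps)
  show ?thesis
    unfolding eq
  proof (rule suminf_le[OF _ s s])
    fix n
    have "u ^ (n + 2) \<le> \<bar>u\<bar> ^ (n + 2)" by (metis abs_ge_self power_abs)
    also have "\<dots> \<le> v ^ (n + 2)" using assms by (intro power_mono) auto
    finally show "inverse (fact (n + 2)) * u ^ (n + 2) \<le> inverse (fact (n + 2)) * v ^ (n + 2)"
      by (intro mult_left_mono) auto
  qed
qed

lemma resample_resample:
  assumes "S \<inter> U = {}"
  shows "resample U (resample S \<omega> \<omega>1) \<omega>2 = resample (S \<union> U) \<omega> (resample U \<omega>1 \<omega>2)"
  using assms by (auto simp: resample_def)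

lemma resample_empty [simp]: "resample {} \<omega> \<omega>' = \<omega>"
  by (simp add: resample_def)

lemma resample_add_point_in: "y \<in> U \<Longrightarrow> resample U (add_point y \<omega>) \<omega>' = resample U \<omega> \<omega>'"
  by (auto simp: resample_def add_point_def)

lemma resample_add_point_notin:
  "y \<notin> U \<Longrightarrow> resample U (add_point y \<omega>) \<omega>' = add_point y (resample U \<omega> \<omega>')"
  by (auto simp: resample_def add_point_def)

section \<open>Conditional means by resampling, and their Lipschitz property\<close>

context poisson_process
begin

sublocale PP: pair_prob_space P P ..

text \<open>The conditional expectation of \<open>F\<close> given the points outside
  \<open>U\<close>.\<close>

definition resample_mean :: "'a set \<Rightarrow> ('a set \<Rightarrow> real) \<Rightarrow> 'a set \<Rightarrow> real" where
  "resample_mean U F \<omega> = (\<integral>\<omega>'. F (resample U \<omega> \<omega>') \<partial>P)"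

text \<open>The quantifier over \<open>y\<close> is outermost because resampling acts on the
  configuration with \<open>y\<close> held fixed: null sets of configurations are then transported
  by \<open>AE_resample\<close> for each \<open>y\<close> separately.\<close>

definition lipschitz_difference :: "real \<Rightarrow> ('a set \<Rightarrow> real) \<Rightarrow> bool" where
  "lipschitz_difference c F \<longleftrightarrow>
     (AE y in \<nu>. AE \<omega> in P. \<bar>F (add_point y \<omega>) - F \<omega>\<bar> \<le> c * norm y)"

lemma prob_configurations [simp]: "prob configurations = 1"
  using prob_space by simp

lemma integrable_bounded:
  fixes F :: "'a set \<Rightarrow> real"
  assumes "F \<in> borel_measurable P" "\<And>\<omega>. \<omega> \<in> configurations \<Longrightarrow> \<bar>F \<omega>\<bar> \<le> M"
  shows "integrable P F"
  by (rule integrable_const_bound[where B = M]) (use assms in auto)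

lemma integrable_indicator_P: "A \<in> sets P \<Longrightarrow> integrable P (indicator A :: _ \<Rightarrow> real)"
  by (rule integrable_real_indicator) (simp_all add: less_top[symmetric])

lemma measurable_resample_right:
  assumes "U \<in> sets borel" "\<omega> \<in> configurations"
  shows "resample U \<omega> \<in> measurable P P"
  using measurable_compose[OF measurable_Pair1' measurable_resample_P[OF assms(1)], of \<omega>] assms(2)
  by simp

lemma measurable_Diff:
  assumes "S \<in> sets borel"
  shows "(\<lambda>\<omega>. \<omega> - S) \<in> measurable P P"
proof -
  have "{} \<in> configurations" by (simp add: configurations_def)
  then have "(\<lambda>\<omega>. (\<omega>, {})) \<in> measurable P (P \<Otimes>\<^sub>M P)" by (intro measurable_Pair2') simp
  from measurable_compose[OF this measurable_resample_P[OF assms]]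
  show ?thesis by (simp add: resample_def)
qed

lemma measurable_F_resample:
  assumes "U \<in> sets borel" "F \<in> borel_measurable P"
  shows "(\<lambda>p. F (resample U (fst p) (snd p))) \<in> borel_measurable (P \<Otimes>\<^sub>M P)"
  by (rule measurable_compose[OF measurable_resample_P[OF assms(1)] assms(2)])

lemma measurable_resample_mean:
  assumes "U \<in> sets borel" "F \<in> borel_measurable P"
  shows "resample_mean U F \<in> borel_measurable P"
  unfolding resample_mean_def[abs_def]
  by (rule borel_measurable_lebesgue_integral)
    (use measurable_F_resample[OF assms] in \<open>simp add: case_prod_beta\<close>)

lemma integrable_resample:
  fixes F :: "'a set \<Rightarrow> real"
  assumes "U \<in> sets borel" "F \<in> borel_measurable P" "\<And>\<omega>. \<omega> \<in> configurations \<Longrightarrow> \<bar>F \<omega>\<bar> \<le> M"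
    and "\<omega> \<in> configurations"
  shows "integrable P (\<lambda>\<omega>'. F (resample U \<omega> \<omega>'))"
proof (rule integrable_bounded)
  show "(\<lambda>\<omega>'. F (resample U \<omega> \<omega>')) \<in> borel_measurable P"
    by (rule measurable_compose[OF measurable_resample_right[OF assms(1,4)] assms(2)])
qed (use assms(3,4) in \<open>auto intro!: resample_in_configurations\<close>)

lemma abs_resample_mean_le:
  assumes "U \<in> sets borel" "F \<in> borel_measurable P" "\<And>\<omega>. \<omega> \<in> configurations \<Longrightarrow> \<bar>F \<omega>\<bar> \<le> M"
    and "\<omega> \<in> configurations"
  shows "\<bar>resample_mean U F \<omega>\<bar> \<le> M"
proof -
  have "\<bar>resample_mean U F \<omega>\<bar> \<le> (\<integral>\<omega>'. \<bar>F (resample U \<omega> \<omega>')\<bar> \<partial>P)"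
    unfolding resample_mean_def by (rule integral_abs_bound)
  also have "\<dots> \<le> (\<integral>\<omega>'. M \<partial>P)"
    using integrable_resample[OF assms] assms(3,4) resample_in_configurations
    by (intro integral_mono) auto
  finally show ?thesis by (simp add: prob_space)
qed

text \<open>Invariance of \<open>P\<close> under resampling combined with Fubini: the tower property
  for the explicit conditional mean.\<close>

lemma
  assumes "U \<in> sets borel" "integrable P F"
  shows integral_resample_mean: "(\<integral>\<omega>. resample_mean U F \<omega> \<partial>P) = (\<integral>\<omega>. F \<omega> \<partial>P)"
    and integrable_resample_mean: "integrable P (resample_mean U F)"
proof -
  have "integrable (distr (P \<Otimes>\<^sub>M P) P (\<lambda>p. resample U (fst p) (snd p))) F"
    unfolding distr_resample[OF assms(1)] by (rule assms(2))
  from integrable_distr[OF measurable_resample_P[OF assms(1)] this]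
  have int: "integrable (P \<Otimes>\<^sub>M P) (\<lambda>p. F (resample U (fst p) (snd p)))" .
  show "integrable P (resample_mean U F)"
    unfolding resample_mean_def[abs_def] using PP.integrable_fst'[OF int] by simp
  have "(\<integral>\<omega>. F \<omega> \<partial>P) = (\<integral>\<omega>. F \<omega> \<partial>distr (P \<Otimes>\<^sub>M P) P (\<lambda>p. resample U (fst p) (snd p)))"
    by (simp add: distr_resample[OF assms(1)])
  also have "\<dots> = (\<integral>p. F (resample U (fst p) (snd p)) \<partial>(P \<Otimes>\<^sub>M P))"
    using assms(2) by (intro integral_distr[OF measurable_resample_P[OF assms(1)]]) simp
  also have "\<dots> = (\<integral>\<omega>. resample_mean U F \<omega> \<partial>P)"
    unfolding resample_mean_def
    using PP.integral_fst'[OF int] by simp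
  finally show "(\<integral>\<omega>. resample_mean U F \<omega> \<partial>P) = (\<integral>\<omega>. F \<omega> \<partial>P)" ..
qed

lemma resample_mean_empty: "resample_mean {} F \<omega> = F \<omega>"
  by (simp add: resample_mean_def prob_space)

text \<open>Resampling \<open>S\<close> and then \<open>U\<close> uses on \<open>U\<close> only the
  second copy, so with \<open>\<omega>\<close> fixed the inner average is a
  \<open>resample_mean\<close> over \<open>U\<close> of a function of the first copy. Its integral
  drops the resampling.\<close>

lemma resample_mean_Un:
  assumes "U \<in> sets borel" "S \<in> sets borel" "S \<inter> U = {}"
    and "F \<in> borel_measurable P" "\<And>\<omega>. \<omega> \<in> configurations \<Longrightarrow> \<bar>F \<omega>\<bar> \<le> M" "\<omega> \<in> configurations"
  shows "resample_mean S (resample_mean U F) \<omega> = resample_mean (S \<union> U) F \<omega>"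
proof -
  let ?G = "\<lambda>\<zeta>. F (resample (S \<union> U) \<omega> \<zeta>)"
  have "resample_mean S (resample_mean U F) \<omega> = (\<integral>\<omega>1. resample_mean U ?G \<omega>1 \<partial>P)"
    by (simp add: resample_mean_def resample_resample[OF assms(3)])
  also have "\<dots> = (\<integral>\<zeta>. ?G \<zeta> \<partial>P)"
  proof (rule integral_resample_mean[OF assms(1) integrable_bounded])
    show "?G \<in> borel_measurable P"
      by (rule measurable_compose[OF measurable_resample_right assms(4)]) (use assms in auto)
    show "\<bar>?G \<zeta>\<bar> \<le> M" if "\<zeta> \<in> configurations" for \<zeta>
      using assms(5,6) that by (simp add: resample_in_configurations)
  qed
  finally show ?thesis by (simp add: resample_mean_def)
qed

lemma AE_resample:
  assumes "AE \<omega> in P. Q \<omega>" "U \<in> sets borel"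
  shows "AE \<omega> in P. AE \<omega>' in P. Q (resample U \<omega> \<omega>')"
proof -
  have "AE p in P \<Otimes>\<^sub>M P. Q (resample U (fst p) (snd p))"
    by (rule AE_distrD[OF measurable_resample_P[OF assms(2)]])
      (unfold distr_resample[OF assms(2)], rule assms(1))
  from PP.AE_pair[OF this] show ?thesis by simp
qed

text \<open>A new point inside \<open>U\<close> is erased by the resampling and changes nothing;
  outside \<open>U\<close> its insertion commutes with the resampling, so the bound is averaged.
  This is what allows the shells to be treated one after another.\<close>

lemma lipschitz_difference_resample_mean:
  assumes "U \<in> sets borel" "F \<in> borel_measurable P" "\<And>\<omega>. \<omega> \<in> configurations \<Longrightarrow> \<bar>F \<omega>\<bar> \<le> M"
    and "lipschitz_difference c F" "c \<ge> 0"
  shows "lipschitz_difference c (resample_mean U F)"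
  using assms(4) unfolding lipschitz_difference_def
proof (rule eventually_mono)
  fix y assume y: "AE \<omega> in P. \<bar>F (add_point y \<omega>) - F \<omega>\<bar> \<le> c * norm y"
  show "AE \<omega> in P. \<bar>resample_mean U F (add_point y \<omega>) - resample_mean U F \<omega>\<bar> \<le> c * norm y"
  proof (cases "y \<in> U")
    case True
    then show ?thesis using assms(5) by (simp add: resample_mean_def resample_add_point_in)
  next
    case False
    have "AE \<omega> in P. \<omega> \<in> configurations" using AE_space[of P] by simp
    with AE_resample[OF y assms(1)] show ?thesis
    proof eventually_elim
      case (elim \<omega>)
      have i1: "integrable P (\<lambda>\<omega>'. F (resample U \<omega> \<omega>'))"
        by (rule integrable_resample[OF assms(1-3) elim(2)])
      have i2: "integrable P (\<lambda>\<omega>'. F (resample U (add_point y \<omega>) \<omega>'))"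
        by (rule integrable_resample[OF assms(1-3)]) (use elim(2) add_point_in_configurations in auto)
      have "\<bar>resample_mean U F (add_point y \<omega>) - resample_mean U F \<omega>\<bar>
          = \<bar>\<integral>\<omega>'. F (resample U (add_point y \<omega>) \<omega>') - F (resample U \<omega> \<omega>') \<partial>P\<bar>"
        using i1 i2 by (simp add: resample_mean_def)
      also have "\<dots> \<le> (\<integral>\<omega>'. \<bar>F (resample U (add_point y \<omega>) \<omega>') - F (resample U \<omega> \<omega>')\<bar> \<partial>P)"
        by (rule integral_abs_bound)
      also have "\<dots> \<le> (\<integral>\<omega>'. c * norm y \<partial>P)"
        using i1 i2 elim(1) False
        by (intro integral_mono_AE) (auto simp: resample_add_point_notin)
      finally show ?case by (simp add: prob_space)
    qed
  qed
qed

lemma prob_no_points: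
  assumes "S \<in> sets borel" "emeasure \<nu> S < \<infinity>"
  shows "prob {\<omega> \<in> configurations. \<omega> \<inter> S = {}} = exp (- measure \<nu> S)"
  using prob_num_points[OF assms, of 0] by (simp add: num_points_eq_0_iff)

lemma sets_no_points:
  assumes [measurable]: "S \<in> sets borel"
  shows "{\<omega> \<in> configurations. \<omega> \<inter> S = {}} \<in> sets P"
proof -
  have "{\<omega> \<in> space P. num_points S \<omega> = 0} \<in> sets P" by measurable
  then show ?thesis by (simp add: num_points_eq_0_iff)
qed

lemma AE_no_points:
  assumes "S \<in> sets borel" "emeasure \<nu> S = 0"
  shows "AE \<omega> in P. \<omega> \<inter> S = {}"
proof -
  have "prob {\<omega> \<in> space P. \<omega> \<inter> S = {}} = 1"
    using prob_no_points[OF assms(1)] assms(2) by (simp add: measure_def)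
  then show ?thesis
    using sets_no_points[OF assms(1)] by (subst (asm) prob_Collect_eq_1) auto
qed

text \<open>Configurations without points in \<open>S\<close> have probability exp(-\<nu>(S)) > 0,
  and resampling \<open>S\<close> by one of them produces \<open>\<omega> - S\<close>. A failure at
  \<open>\<omega> - S\<close> would therefore be a failure on a set of copies of positive
  probability. The emptied configuration is the reference point from which the effect of a single
  shell is measured.\<close>

lemma lipschitz_difference_Diff:
  assumes "lipschitz_difference c F" "S \<in> sets borel" "emeasure \<nu> S < \<infinity>"
  shows "AE y in \<nu>. AE \<omega> in P. \<bar>F (add_point y (\<omega> - S)) - F (\<omega> - S)\<bar> \<le> c * norm y"
  using assms(1) unfolding lipschitz_difference_def
proof (rule eventually_mono)
  fix y assume "AE \<omega> in P. \<bar>F (add_point y \<omega>) - F \<omega>\<bar> \<le> c * norm y"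
  from AE_resample[OF this assms(2)]
  show "AE \<omega> in P. \<bar>F (add_point y (\<omega> - S)) - F (\<omega> - S)\<bar> \<le> c * norm y"
  proof eventually_elim
    case (elim \<omega>)
    show ?case
    proof (rule ccontr)
      assume contra: "\<not> ?thesis"
      have "AE \<omega>' in P. \<not> \<omega>' \<inter> S = {}"
        using elim
      proof eventually_elim
        case (elim \<omega>')
        show ?case
        proof
          assume "\<omega>' \<inter> S = {}"
          then have "resample S \<omega> \<omega>' = \<omega> - S" by (simp add: resample_def)
          with elim contra show False by simp
        qed
      qed
      then have "prob {\<omega> \<in> space P. \<omega> \<inter> S = {}} = 0"
        using sets_no_points[OF assms(2)] by (subst prob_Collect_eq_0) auto
      with prob_no_points[OF assms(2,3)] show False by simp
    qed
  qed
qed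

lemma measurable_difference:
  assumes F: "F \<in> borel_measurable P" and h: "h \<in> measurable P P"
  shows "{p \<in> space (P \<Otimes>\<^sub>M \<nu>). \<bar>F (add_point (snd p) (h (fst p))) - F (h (fst p))\<bar> \<le> c * norm (snd p)}
    \<in> sets (P \<Otimes>\<^sub>M \<nu>)"
proof -
  have "(\<lambda>p. add_point (snd p) (fst p)) \<in> measurable (P \<Otimes>\<^sub>M \<nu>) P"
    unfolding measurable_cong_sets[OF sets_pair_measure_cong[OF sets_P sets_intensity] sets_P]
    by (rule measurable_add_point)
  then have [measurable]: "(\<lambda>p. add_point (snd p) (h (fst p))) \<in> measurable (P \<Otimes>\<^sub>M \<nu>) P"
    using h by (rule_tac measurable_compose[where g = "\<lambda>p. add_point (snd p) (fst p)" and f = "\<lambda>p. (h (fst p), snd p)", simplified]) auto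
  note F[measurable] h[measurable]
  have [measurable]: "snd \<in> borel_measurable (P \<Otimes>\<^sub>M \<nu>)"
    using measurable_snd[of P \<nu>] by (simp add: measurable_cong_sets[OF refl sets_intensity])
  show ?thesis by measurable
qed

text \<open>With one point in \<open>S\<close> the increment is controlled by the Lipschitz condition; two or more
  points only have probability of order \<open>\<nu>(S)\<^sup>2\<close>, where the trivial bound suffices.\<close>
lemma one_shell:
  assumes F: "F \<in> borel_measurable P" and M: "\<And>\<omega>. \<omega> \<in> configurations \<Longrightarrow> \<bar>F \<omega>\<bar> \<le> M"
    and lip: "lipschitz_difference c F" "c \<ge> 0"
    and S: "S \<in> sets borel" "emeasure \<nu> S < \<infinity>" "\<And>y. y \<in> S \<Longrightarrow> norm y \<le> \<rho>" "0 \<notin> S" "\<rho> \<ge> 0"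
    and t: "t \<ge> 0"
  defines "l \<equiv> measure \<nu> S"
  shows "(\<integral>\<omega>. exp (t * F \<omega>) \<partial>P) \<le>
    exp (exp (2 * t * M * l) * (l * (exp (t * (c * \<rho>)) - 1 - t * (c * \<rho>)) + l\<^sup>2 * (exp (2 * t * M) - 1 - 2 * t * M)))
      * (\<integral>\<omega>. exp (t * resample_mean S F \<omega>) \<partial>P)"
proof -
  interpret nu: sigma_finite_measure \<nu> by (rule sigma_finite_intensity)
  interpret PN: pair_sigma_finite P \<nu> ..
  define g1 where "g1 = exp (t * (c * \<rho>)) - 1 - t * (c * \<rho>)"
  define g2 where "g2 = exp (2 * t * M) - 1 - 2 * t * M"
  define a where "a = l * g1 + l\<^sup>2 * g2"
  have l: "l \<ge> 0" by (simp add: l_def)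
  have M0: "M \<ge> 0"
    using M[of "{}"] by (auto simp: configurations_def)
  have g: "g1 \<ge> 0" "g2 \<ge> 0" unfolding g1_def g2_def by (rule exp_remainder_nonneg)+
  have a: "a \<ge> 0" using l g by (simp add: a_def)
  note mS = measurable_Diff[OF S(1)]
  \<comment> \<open>Here the configuration has to be fixed first and the exceptional points
    \<open>y\<close> collected afterwards, so the order of the two quantifiers is swapped by
    Fubini.\<close>
  define Q where "Q \<omega> y \<longleftrightarrow> \<bar>F (add_point y (\<omega> - S)) - F (\<omega> - S)\<bar> \<le> c * norm y" for \<omega> y
  have Qsets: "{p \<in> space (P \<Otimes>\<^sub>M \<nu>). Q (fst p) (snd p)} \<in> sets (P \<Otimes>\<^sub>M \<nu>)"
    unfolding Q_def by (rule measurable_difference[OF F mS])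
  have "AE y in \<nu>. AE \<omega> in P. Q \<omega> y"
    unfolding Q_def by (rule lipschitz_difference_Diff[OF lip(1) S(1,2)])
  then have AEQ: "AE \<omega> in P. AE y in \<nu>. Q \<omega> y"
    using PN.AE_commute[OF Qsets] by simp
  define A0 where "A0 = {\<omega> \<in> configurations. num_points S \<omega> = 0}"
  define A1 where "A1 = {\<omega> \<in> configurations. num_points S \<omega> = 1}"
  define A2 where "A2 = configurations - A0 - A1"
  note S(1)[measurable]
  have "{\<omega> \<in> space P. num_points S \<omega> = 0} \<in> sets P" "{\<omega> \<in> space P. num_points S \<omega> = 1} \<in> sets P"
    by measurable
  then have A[measurable]: "A0 \<in> sets P" "A1 \<in> sets P" by (simp_all add: A0_def A1_def)
  have A2_eq: "A2 = space P - A0 - A1" by (simp add: A2_def)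
  have A2[measurable]: "A2 \<in> sets P" unfolding A2_eq by (intro sets.Diff sets.top A)
  have Asub: "A1 \<inter> configurations = A1" "A2 \<inter> configurations = A2"
    by (auto simp: A1_def A2_def)
  have p0: "prob A0 = exp (- l)" and p1: "prob A1 = exp (- l) * l"
    using prob_num_points[OF S(1,2), of 0] prob_num_points[OF S(1,2), of 1]
    by (simp_all add: A0_def A1_def l_def)
  have disj: "A0 \<inter> A1 = {}" by (auto simp: A0_def A1_def)
  have p12: "prob (A1 \<union> A2) = 1 - exp (- l)"
  proof -
    have "A1 \<union> A2 = space P - A0" using disj by (auto simp: A2_def A1_def)
    then show ?thesis using prob_compl[OF A(1)] p0 by simp
  qed
  have p2: "prob A2 = 1 - exp (- l) - exp (- l) * l"
  proof -
    have "prob (A1 \<union> A2) = prob A1 + prob A2"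
      by (rule finite_measure_Union[OF A(2) A2]) (auto simp: A2_def)
    then show ?thesis using p12 p1 by simp
  qed
  have e: "exp (- l) \<ge> 1 - l" using exp_ge_add_one_self[of "- l"] by simp
  have p1_le: "prob A1 \<le> l" unfolding p1 using l by (simp add: mult_left_le_one_le)
  have p2_le: "prob A2 \<le> l\<^sup>2"
  proof -
    have "(1 - l) * (1 + l) \<le> exp (- l) * (1 + l)" using e l by (intro mult_right_mono) auto
    then show ?thesis unfolding p2 by (simp add: power2_eq_square algebra_simps)
  qed
  have p12_le: "prob (A1 \<union> A2) \<le> l" using p12 e by simp
  have key: "(\<integral>\<omega>'. exp (t * F (resample S \<omega> \<omega>')) \<partial>P) \<le> exp (exp (2 * t * M * l) * a) * exp (t * resample_mean S F \<omega>)"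
    if \<omega>: "\<omega> \<in> configurations" and good: "AE y in \<nu>. Q \<omega> y" for \<omega>
  proof -
    \<comment> \<open>Measured from the emptied shell, the increment vanishes when the copy has no
      point in \<open>S\<close> and is a single difference when it has one.\<close>
    define X where "X \<omega>' = F (resample S \<omega> \<omega>') - F (\<omega> - S)" for \<omega>'
    have \<omega>S: "\<omega> - S \<in> configurations" using \<omega> by (rule configurations_mono) auto
    have Xm[measurable]: "X \<in> borel_measurable P"
      unfolding X_def[abs_def]
      by (intro borel_measurable_diff measurable_compose[OF measurable_resample_right[OF S(1) \<omega>] F]) auto
    have Xb: "\<bar>X \<omega>'\<bar> \<le> 2 * M" if "\<omega>' \<in> configurations" for \<omega>'
      using M[OF resample_in_configurations[OF \<omega> that, of S]] M[OF \<omega>S] by (simp add: X_def)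
    have Xint: "integrable P X" by (rule integrable_bounded[OF Xm Xb])
    have eXint: "integrable P (\<lambda>\<omega>'. exp (t * X \<omega>'))"
      by (rule integrable_bounded[where M = "exp (t * (2 * M))"])
        (use Xb t in \<open>auto intro!: mult_left_mono simp: abs_le_iff\<close>)
    \<comment> \<open>The point that the copy puts into \<open>S\<close> must not be one where the
      Lipschitz bound fails. Such points form a null set for the intensity, and almost surely the
      copy has no point there.\<close>
    obtain N where N: "{y \<in> space \<nu>. \<not> Q \<omega> y} \<subseteq> N" "emeasure \<nu> N = 0" "N \<in> sets \<nu>"
      using good by (rule AE_E)
    define C where "C = S \<inter> N"
    have C: "C \<in> sets borel" "emeasure \<nu> C = 0"
      using N S(1) emeasure_mono[of C N \<nu>] by (auto simp: C_def sets_intensity)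
    have X0: "X \<omega>' = 0" if "\<omega>' \<in> A0" for \<omega>'
      using that by (auto simp: A0_def X_def resample_def num_points_eq_0_iff)
    have X1: "\<bar>X \<omega>'\<bar> \<le> c * \<rho>" if "\<omega>' \<in> A1" "\<omega>' \<inter> C = {}" for \<omega>'
    proof -
      obtain y where y: "\<omega>' \<inter> S = {y}"
        using \<open>\<omega>' \<in> A1\<close> by (auto simp: A1_def num_points_eq_1_iff)
      then have yS: "y \<in> S" "y \<noteq> 0" "y \<notin> N" using that(2) S(4) by (auto simp: C_def)
      have "y \<in> space \<nu>" using sets_eq_imp_space_eq[OF sets_intensity] by simp
      then have "Q \<omega> y" using N(1) yS(3) by auto
      moreover have "resample S \<omega> \<omega>' = add_point y (\<omega> - S)"
        using y yS by (auto simp: resample_def add_point_def)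
      ultimately have "\<bar>X \<omega>'\<bar> \<le> c * norm y" by (simp add: Q_def X_def)
      also have "\<dots> \<le> c * \<rho>" using S(3)[OF yS(1)] lip(2) by (intro mult_left_mono)
      finally show ?thesis .
    qed
    have AEC: "AE \<omega>' in P. \<omega>' \<in> configurations \<and> \<omega>' \<inter> C = {}"
      using AE_no_points[OF C] AE_space[of P] by auto
    \<comment> \<open>The linear term is kept exactly, since it becomes the conditional mean. Only
      the remainders are estimated, with the Lipschitz bound for one point and the bound
      \<open>2 * M\<close> for several.\<close>
    have "(\<integral>\<omega>'. exp (t * X \<omega>') \<partial>P) \<le> (\<integral>\<omega>'. 1 + t * X \<omega>' + g1 * indicator A1 \<omega>' + g2 * indicator A2 \<omega>' \<partial>P)"
    proof (rule integral_mono_AE[OF eXint])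
      show "integrable P (\<lambda>\<omega>'. 1 + t * X \<omega>' + g1 * indicator A1 \<omega>' + g2 * indicator A2 \<omega>')"
        by (intro Bochner_Integration.integrable_add integrable_mult_right integrable_indicator_P A A2 Xint) simp
      show "AE \<omega>' in P. exp (t * X \<omega>') \<le> 1 + t * X \<omega>' + g1 * indicator A1 \<omega>' + g2 * indicator A2 \<omega>'"
        using AEC
      proof eventually_elim
        case (elim \<omega>')
        consider "\<omega>' \<in> A0" | "\<omega>' \<in> A1" | "\<omega>' \<in> A2" using elim by (auto simp: A2_def)
        then show ?case
        proof cases
          case 1
          with disj g X0 show ?thesis by (auto simp: A2_def indicator_def)
        next
          case 2
          have "\<bar>t * X \<omega>'\<bar> \<le> t * (c * \<rho>)"
            unfolding abs_mult using X1[OF 2] elim t by (simp add: mult_left_mono)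
          from exp_remainder_mono[OF this] 2 show ?thesis by (auto simp: A2_def g1_def indicator_def)
        next
          case 3
          have "\<bar>t * X \<omega>'\<bar> \<le> t * (2 * M)"
            unfolding abs_mult using Xb elim t by (simp add: mult_left_mono)
          from exp_remainder_mono[OF this] 3 show ?thesis
            by (auto simp: A2_def g2_def indicator_def mult.assoc mult.left_commute)
        qed
      qed
    qed
    also have "\<dots> = 1 + t * (\<integral>\<omega>'. X \<omega>' \<partial>P) + g1 * prob A1 + g2 * prob A2"
      using Xint A A2 integrable_indicator_P by (simp add: Asub)
    also have "\<dots> \<le> 1 + t * (\<integral>\<omega>'. X \<omega>' \<partial>P) + a"
      unfolding a_def using mult_left_mono[OF p1_le g(1)] mult_left_mono[OF p2_le g(2)] by (simp add: mult.commute)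
    also have "\<dots> \<le> exp (t * (\<integral>\<omega>'. X \<omega>' \<partial>P)) + a"
      using exp_ge_add_one_self by simp
    \<comment> \<open>The additive error becomes a factor. At least one point falls into the shell
      with probability at most \<open>l\<close>, so the mean of \<open>X\<close> is at least -2Ml
      and the exponential of t times it at least exp(-2tMl). This is the origin of the prefactor
      \<open>exp (2 * t * M * l)\<close>.\<close>
    also have "\<dots> \<le> exp (t * (\<integral>\<omega>'. X \<omega>' \<partial>P)) * exp (exp (2 * t * M * l) * a)"
    proof -
      have "\<bar>\<integral>\<omega>'. X \<omega>' \<partial>P\<bar> \<le> (\<integral>\<omega>'. \<bar>X \<omega>'\<bar> \<partial>P)" by (rule integral_abs_bound)
      also have "\<dots> \<le> (\<integral>\<omega>'. 2 * M * indicator (A1 \<union> A2) \<omega>' \<partial>P)"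
      proof (rule integral_mono_AE)
        show "AE \<omega>' in P. \<bar>X \<omega>'\<bar> \<le> 2 * M * indicator (A1 \<union> A2) \<omega>'"
          using AE_space
        proof eventually_elim
          case (elim \<omega>')
          then show ?case using Xb[of \<omega>'] X0[of \<omega>'] by (cases "\<omega>' \<in> A0") (auto simp: A2_def indicator_def M0)
        qed
        show "integrable P (\<lambda>\<omega>'. 2 * M * indicator (A1 \<union> A2) \<omega>')"
          by (intro integrable_mult_right integrable_indicator_P sets.Un A A2)
      qed (use Xint in simp)
      also have "\<dots> = 2 * M * prob (A1 \<union> A2)"
        by (simp add: Int_Un_distrib2 Asub)
      also have "\<dots> \<le> 2 * M * l" using p12_le M0 by (intro mult_left_mono) auto
      finally have EX: "\<bar>\<integral>\<omega>'. X \<omega>' \<partial>P\<bar> \<le> 2 * M * l" .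
      have "t * - (\<integral>\<omega>'. X \<omega>' \<partial>P) \<le> t * (2 * M * l)"
        using EX t by (intro mult_left_mono) auto
      then have "1 \<le> exp (t * (\<integral>\<omega>'. X \<omega>' \<partial>P)) * exp (2 * t * M * l)"
        by (simp add: exp_add[symmetric] algebra_simps)
      from mult_right_mono[OF this a]
      have "exp (t * (\<integral>\<omega>'. X \<omega>' \<partial>P)) + a \<le> exp (t * (\<integral>\<omega>'. X \<omega>' \<partial>P)) * (1 + exp (2 * t * M * l) * a)"
        by (simp add: algebra_simps)
      also have "\<dots> \<le> exp (t * (\<integral>\<omega>'. X \<omega>' \<partial>P)) * exp (exp (2 * t * M * l) * a)"
        by (intro mult_left_mono exp_ge_add_one_self) auto
      finally show ?thesis .
    qed
    finally have main: "(\<integral>\<omega>'. exp (t * X \<omega>') \<partial>P) \<le> exp (t * (\<integral>\<omega>'. X \<omega>' \<partial>P)) * exp (exp (2 * t * M * l) * a)" .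
    have "(\<integral>\<omega>'. exp (t * F (resample S \<omega> \<omega>')) \<partial>P) = (\<integral>\<omega>'. exp (t * F (\<omega> - S)) * exp (t * X \<omega>') \<partial>P)"
      by (simp add: X_def exp_add[symmetric] algebra_simps)
    also have "\<dots> = exp (t * F (\<omega> - S)) * (\<integral>\<omega>'. exp (t * X \<omega>') \<partial>P)"
      by simp
    also have "\<dots> \<le> exp (t * F (\<omega> - S)) * (exp (t * (\<integral>\<omega>'. X \<omega>' \<partial>P)) * exp (exp (2 * t * M * l) * a))"
      by (intro mult_left_mono main) auto
    also have "(\<integral>\<omega>'. X \<omega>' \<partial>P) = resample_mean S F \<omega> - F (\<omega> - S)"
      unfolding X_def resample_mean_def
      using integrable_resample[OF S(1) F M \<omega>] by (simp add: prob_space)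
    finally show ?thesis by (simp add: exp_add[symmetric] algebra_simps)
  qed
  have expF: "(\<lambda>\<omega>. exp (t * F \<omega>)) \<in> borel_measurable P" using F by measurable
  have expFb: "\<bar>exp (t * F \<omega>)\<bar> \<le> exp (t * M)" if "\<omega> \<in> configurations" for \<omega>
    using M[OF that] t by (auto intro!: mult_left_mono simp: abs_le_iff)
  have Tm: "resample_mean S F \<in> borel_measurable P" by (rule measurable_resample_mean[OF S(1) F])
  have Tb: "\<bar>exp (t * resample_mean S F \<omega>)\<bar> \<le> exp (t * M)" if "\<omega> \<in> configurations" for \<omega>
    using abs_resample_mean_le[OF S(1) F M that] t by (auto intro!: mult_left_mono simp: abs_le_iff)
  have "(\<integral>\<omega>. exp (t * F \<omega>) \<partial>P) = (\<integral>\<omega>. resample_mean S (\<lambda>\<omega>. exp (t * F \<omega>)) \<omega> \<partial>P)"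
    by (rule integral_resample_mean[OF S(1) integrable_bounded[OF expF expFb], symmetric])
  also have "\<dots> \<le> (\<integral>\<omega>. exp (exp (2 * t * M * l) * a) * exp (t * resample_mean S F \<omega>) \<partial>P)"
  proof (rule integral_mono_AE)
    show "integrable P (resample_mean S (\<lambda>\<omega>. exp (t * F \<omega>)))"
      by (rule integrable_resample_mean[OF S(1) integrable_bounded[OF expF expFb]])
    have "integrable P (\<lambda>\<omega>. exp (t * resample_mean S F \<omega>))"
      by (rule integrable_bounded[OF _ Tb])
        (rule measurable_compose[OF borel_measurable_times[OF borel_measurable_const Tm] borel_measurable_exp])
    then show "integrable P (\<lambda>\<omega>. exp (exp (2 * t * M * l) * a) * exp (t * resample_mean S F \<omega>))" by simp
    show "AE \<omega> in P. resample_mean S (\<lambda>\<omega>. exp (t * F \<omega>)) \<omega> \<le> exp (exp (2 * t * M * l) * a) * exp (t * resample_mean S F \<omega>)"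
      using AEQ AE_space[of P]
    proof eventually_elim
      case (elim \<omega>)
      then show ?case using key[of \<omega>] by (simp add: resample_mean_def)
    qed
  qed
  also have "\<dots> = exp (exp (2 * t * M * l) * a) * (\<integral>\<omega>. exp (t * resample_mean S F \<omega>) \<partial>P)"
    by simp
  finally show ?thesis by (simp add: a_def g1_def g2_def)
qed

end

context poisson_process
begin

text \<open>Averaging over a shell preserves both the bound \<open>M\<close> and the Lipschitz
  condition, so \<open>one_shell\<close> applies in turn to the functional already averaged over the
  earlier shells, and the costs add up in the exponent.\<close>

lemma shells_bound:
  fixes S :: "nat \<Rightarrow> 'a set"
  assumes F: "F \<in> borel_measurable P" and M: "\<And>\<omega>. \<omega> \<in> configurations \<Longrightarrow> \<bar>F \<omega>\<bar> \<le> M"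
    and lip: "lipschitz_difference c F" "c \<ge> 0"
    and disj: "disjoint_family_on S {..<n}"
    and S: "\<And>i. i < n \<Longrightarrow> S i \<in> sets borel" "\<And>i. i < n \<Longrightarrow> emeasure \<nu> (S i) < \<infinity>"
      "\<And>i y. i < n \<Longrightarrow> y \<in> S i \<Longrightarrow> norm y \<le> \<rho> i"
      "\<And>i. i < n \<Longrightarrow> 0 \<notin> S i" "\<And>i. i < n \<Longrightarrow> \<rho> i \<ge> 0"
    and t: "t \<ge> 0"
  defines "l \<equiv> \<lambda>i. measure \<nu> (S i)"
  shows "(\<integral>\<omega>. exp (t * F \<omega>) \<partial>P) \<le>
    exp (\<Sum>i<n. exp (2 * t * M * l i) * (l i * (exp (t * (c * \<rho> i)) - 1 - t * (c * \<rho> i))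
        + (l i)\<^sup>2 * (exp (2 * t * M) - 1 - 2 * t * M)))
      * (\<integral>\<omega>. exp (t * resample_mean (\<Union>i<n. S i) F \<omega>) \<partial>P)"
  using disj S unfolding l_def
proof (induction n)
  case 0
  show ?case by (simp add: resample_mean_empty)
next
  case (Suc n)
  let ?l = "\<lambda>i. measure \<nu> (S i)"
  let ?U = "\<Union>i<n. S i" and ?K = "\<lambda>i. exp (2 * t * M * ?l i) * (?l i * (exp (t * (c * \<rho> i)) - 1 - t * (c * \<rho> i))
        + (?l i)\<^sup>2 * (exp (2 * t * M) - 1 - 2 * t * M))"
  have n: "n < Suc n" by simp
  have Sn: "S n \<in> sets borel" by (rule Suc.prems(2)[OF n])
  have U: "?U \<in> sets borel" using Suc.prems(2) by auto
  have "S n \<inter> S i = {}" if "i < n" for i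
    using Suc.prems(1) that unfolding disjoint_family_on_def by force
  then have disj: "S n \<inter> ?U = {}" by blast
  have dn: "disjoint_family_on S {..<n}"
    by (rule disjoint_family_on_mono[OF _ Suc.prems(1)]) auto
  have "(\<integral>\<omega>. exp (t * F \<omega>) \<partial>P) \<le> exp (\<Sum>i<n. ?K i) * (\<integral>\<omega>. exp (t * resample_mean ?U F \<omega>) \<partial>P)"
    by (rule Suc.IH[OF dn Suc.prems(2-6)]) auto
  also have "\<dots> \<le> exp (\<Sum>i<n. ?K i) * (exp (?K n) * (\<integral>\<omega>. exp (t * resample_mean (S n) (resample_mean ?U F) \<omega>) \<partial>P))"
  proof (rule mult_left_mono)
    show "(\<integral>\<omega>. exp (t * resample_mean ?U F \<omega>) \<partial>P)
        \<le> exp (?K n) * (\<integral>\<omega>. exp (t * resample_mean (S n) (resample_mean ?U F) \<omega>) \<partial>P)"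
      by (rule one_shell[OF measurable_resample_mean[OF U F] abs_resample_mean_le[OF U F M]
          lipschitz_difference_resample_mean[OF U F M lip] lip(2) Sn Suc.prems(3)[OF n]
          Suc.prems(4)[OF n] Suc.prems(5)[OF n] Suc.prems(6)[OF n] t])
  qed simp
  also have "(\<integral>\<omega>. exp (t * resample_mean (S n) (resample_mean ?U F) \<omega>) \<partial>P)
      = (\<integral>\<omega>. exp (t * resample_mean (\<Union>i<Suc n. S i) F \<omega>) \<partial>P)"
  proof (rule Bochner_Integration.integral_cong[OF refl])
    fix \<omega> assume "\<omega> \<in> space P"
    then have "resample_mean (S n) (resample_mean ?U F) \<omega> = resample_mean (S n \<union> ?U) F \<omega>"
      by (intro resample_mean_Un[OF U Sn disj F M]) auto
    moreover have "S n \<union> ?U = (\<Union>i<Suc n. S i)" by (auto simp: less_Suc_eq)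
    ultimately show "exp (t * resample_mean (S n) (resample_mean ?U F) \<omega>)
        = exp (t * resample_mean (\<Union>i<Suc n. S i) F \<omega>)" by simp
  qed
  finally show ?case by (simp add: exp_add mult.assoc)
qed

section \<open>Zero-one law at the origin\<close>

definition off_zero :: "nat \<Rightarrow> 'a set" where
  "off_zero n = {y. inverse (real (Suc n)) < norm y}"

lemma off_zero_borel [measurable]: "off_zero n \<in> sets borel"
  unfolding off_zero_def by (intro borel_open open_Collect_less continuous_intros)

lemma off_zero_mono: "n \<le> m \<Longrightarrow> off_zero n \<subseteq> off_zero m"
proof
  fix y :: 'a assume "n \<le> m" and y: "y \<in> off_zero n"
  then have "inverse (real (Suc m)) \<le> inverse (real (Suc n))" by (intro le_imp_inverse_le) auto
  from le_less_trans[OF this, of "norm y"] y show "y \<in> off_zero m" by (simp add: off_zero_def)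
qed

definition determined_off_zero :: "('a set \<Rightarrow> real) \<Rightarrow> bool" where
  "determined_off_zero G \<longleftrightarrow> (\<exists>n. \<forall>\<omega>\<in>configurations. G \<omega> = G (\<omega> \<inter> off_zero n))"

text \<open>Membership in the L1 closure of the functionals that ignore a neighbourhood of 0. That
  this closure is all of L1 is the form in which the zero-one law is used here.\<close>

definition approximable_off_zero :: "('a set \<Rightarrow> real) \<Rightarrow> bool" where
  "approximable_off_zero f \<longleftrightarrow> integrable P f \<and>
    (\<forall>\<delta>>0. \<exists>G. integrable P G \<and> determined_off_zero G \<and> (\<integral>\<omega>. \<bar>f \<omega> - G \<omega>\<bar> \<partial>P) < \<delta>)"

lemma Int_off_zero_in_configurations: "\<omega> \<in> configurations \<Longrightarrow> \<omega> \<inter> A \<in> configurations"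
  by (rule configurations_mono) auto

lemma determined_off_zero_mono:
  assumes "\<forall>\<omega>\<in>configurations. G \<omega> = G (\<omega> \<inter> off_zero n)" "n \<le> m" "\<omega> \<in> configurations"
  shows "G (\<omega> \<inter> off_zero m) = G \<omega>"
proof -
  have "\<omega> \<inter> off_zero m \<inter> off_zero n = \<omega> \<inter> off_zero n" using off_zero_mono[OF assms(2)] by auto
  then show ?thesis using assms(1,3) Int_off_zero_in_configurations by metis
qed

lemma determined_off_zero_add:
  assumes "determined_off_zero F" "determined_off_zero G"
  shows "determined_off_zero (\<lambda>\<omega>. F \<omega> + G \<omega>)"
proof -
  obtain n m where "\<forall>\<omega>\<in>configurations. F \<omega> = F (\<omega> \<inter> off_zero n)" "\<forall>\<omega>\<in>configurations. G \<omega> = G (\<omega> \<inter> off_zero m)"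
    using assms by (auto simp: determined_off_zero_def)
  then have "\<forall>\<omega>\<in>configurations. F \<omega> + G \<omega> = F (\<omega> \<inter> off_zero (max n m)) + G (\<omega> \<inter> off_zero (max n m))"
    by (auto simp: determined_off_zero_mono[of F n "max n m"] determined_off_zero_mono[of G m "max n m"])
  then show ?thesis by (auto simp: determined_off_zero_def)
qed

lemma approximable_off_zero_add:
  assumes "approximable_off_zero f" "approximable_off_zero g"
  shows "approximable_off_zero (\<lambda>\<omega>. f \<omega> + g \<omega>)"
  unfolding approximable_off_zero_def
proof (intro conjI allI impI)
  show "integrable P (\<lambda>\<omega>. f \<omega> + g \<omega>)" using assms by (simp add: approximable_off_zero_def)
  fix \<delta> :: real assume "\<delta> > 0"
  then have "\<delta> / 2 > 0" by simp
  with assms obtain F G where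
    F: "integrable P F" "determined_off_zero F" "(\<integral>\<omega>. \<bar>f \<omega> - F \<omega>\<bar> \<partial>P) < \<delta> / 2" and
    G: "integrable P G" "determined_off_zero G" "(\<integral>\<omega>. \<bar>g \<omega> - G \<omega>\<bar> \<partial>P) < \<delta> / 2"
    unfolding approximable_off_zero_def by meson
  have fg: "integrable P f" "integrable P g" using assms by (auto simp: approximable_off_zero_def)
  have "(\<integral>\<omega>. \<bar>f \<omega> + g \<omega> - (F \<omega> + G \<omega>)\<bar> \<partial>P) \<le> (\<integral>\<omega>. \<bar>f \<omega> - F \<omega>\<bar> + \<bar>g \<omega> - G \<omega>\<bar> \<partial>P)"
    using F G fg by (intro integral_mono) auto
  also have "\<dots> < \<delta>" using F G fg by simp
  finally show "\<exists>H. integrable P H \<and> determined_off_zero H \<and> (\<integral>\<omega>. \<bar>f \<omega> + g \<omega> - H \<omega>\<bar> \<partial>P) < \<delta>"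
    using F G determined_off_zero_add[of F G] by (intro exI[of _ "\<lambda>\<omega>. F \<omega> + G \<omega>"]) auto
qed

lemma approximable_off_zero_scale:
  assumes "approximable_off_zero f"
  shows "approximable_off_zero (\<lambda>\<omega>. f \<omega> * a)"
  unfolding approximable_off_zero_def
proof (intro conjI allI impI)
  show "integrable P (\<lambda>\<omega>. f \<omega> * a)" using assms by (simp add: approximable_off_zero_def)
  fix \<delta> :: real assume "\<delta> > 0"
  then have "\<delta> / (\<bar>a\<bar> + 1) > 0" by simp
  with assms obtain F where
    F: "integrable P F" "determined_off_zero F" "(\<integral>\<omega>. \<bar>f \<omega> - F \<omega>\<bar> \<partial>P) < \<delta> / (\<bar>a\<bar> + 1)"
    unfolding approximable_off_zero_def by meson
  have "(\<integral>\<omega>. \<bar>f \<omega> * a - F \<omega> * a\<bar> \<partial>P) = (\<integral>\<omega>. \<bar>f \<omega> - F \<omega>\<bar> \<partial>P) * \<bar>a\<bar>"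
    by (simp add: left_diff_distrib[symmetric] abs_mult)
  also have "\<dots> \<le> (\<integral>\<omega>. \<bar>f \<omega> - F \<omega>\<bar> \<partial>P) * (\<bar>a\<bar> + 1)" by (intro mult_left_mono) auto
  also have "\<dots> < \<delta>" using F(3) by (simp add: pos_less_divide_eq add_pos_nonneg)
  finally show "\<exists>H. integrable P H \<and> determined_off_zero H \<and> (\<integral>\<omega>. \<bar>f \<omega> * a - H \<omega>\<bar> \<partial>P) < \<delta>"
    using F(1,2) by (intro exI[of _ "\<lambda>\<omega>. F \<omega> * a"]) (auto simp: determined_off_zero_def)
qed

text \<open>Dominated convergence. The domination by \<open>2 * \<bar>f \<omega>\<bar>\<close> is
  the form in which \<open>integrable_induct\<close> supplies its approximating sequences.\<close>

lemma approximable_off_zero_limit: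
  assumes s: "\<And>i. approximable_off_zero (s i)"
    and f: "integrable P f"
    and lim: "\<And>\<omega>. \<omega> \<in> configurations \<Longrightarrow> (\<lambda>i. s i \<omega>) \<longlonglongrightarrow> f \<omega>"
    and dom: "\<And>i \<omega>. \<omega> \<in> configurations \<Longrightarrow> \<bar>s i \<omega>\<bar> \<le> 2 * \<bar>f \<omega>\<bar>"
  shows "approximable_off_zero f"
  unfolding approximable_off_zero_def
proof (intro conjI allI impI f)
  fix \<delta> :: real assume \<delta>: "\<delta> > 0"
  have si: "integrable P (s i)" for i using s by (simp add: approximable_off_zero_def)
  have "(\<lambda>i. \<integral>\<omega>. \<bar>f \<omega> - s i \<omega>\<bar> \<partial>P) \<longlonglongrightarrow> (\<integral>\<omega>. 0 \<partial>P)"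
  proof (rule integral_dominated_convergence[where w = "\<lambda>\<omega>. 3 * \<bar>f \<omega>\<bar>"])
    show "AE \<omega> in P. (\<lambda>i. \<bar>f \<omega> - s i \<omega>\<bar>) \<longlonglongrightarrow> 0"
    proof (rule AE_I2)
      fix \<omega> assume "\<omega> \<in> space P"
      then have "(\<lambda>i. \<bar>f \<omega> - s i \<omega>\<bar>) \<longlonglongrightarrow> \<bar>f \<omega> - f \<omega>\<bar>" by (intro tendsto_intros lim) simp
      then show "(\<lambda>i. \<bar>f \<omega> - s i \<omega>\<bar>) \<longlonglongrightarrow> 0" by simp
    qed
    show "AE \<omega> in P. norm \<bar>f \<omega> - s i \<omega>\<bar> \<le> 3 * \<bar>f \<omega>\<bar>" for i
    proof (rule AE_I2)
      fix \<omega> assume "\<omega> \<in> space P"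
      then show "norm \<bar>f \<omega> - s i \<omega>\<bar> \<le> 3 * \<bar>f \<omega>\<bar>" using dom[of \<omega> i] by simp
    qed
  qed (use f si in auto)
  then have "\<forall>\<^sub>F i in sequentially. (\<integral>\<omega>. \<bar>f \<omega> - s i \<omega>\<bar> \<partial>P) < \<delta> / 2"
    using \<delta> by (intro order_tendstoD) auto
  then obtain i where i: "(\<integral>\<omega>. \<bar>f \<omega> - s i \<omega>\<bar> \<partial>P) < \<delta> / 2"
    by (auto simp: eventually_sequentially)
  have "\<delta> / 2 > 0" using \<delta> by simp
  with s[of i] obtain G where
    G: "integrable P G" "determined_off_zero G" "(\<integral>\<omega>. \<bar>s i \<omega> - G \<omega>\<bar> \<partial>P) < \<delta> / 2"
    unfolding approximable_off_zero_def by meson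
  have "(\<integral>\<omega>. \<bar>f \<omega> - G \<omega>\<bar> \<partial>P) \<le> (\<integral>\<omega>. \<bar>f \<omega> - s i \<omega>\<bar> + \<bar>s i \<omega> - G \<omega>\<bar> \<partial>P)"
    using f si[of i] G(1) by (intro integral_mono) auto
  also have "\<dots> < \<delta>" using f si[of i] G i by simp
  finally show "\<exists>G. integrable P G \<and> determined_off_zero G \<and> (\<integral>\<omega>. \<bar>f \<omega> - G \<omega>\<bar> \<partial>P) < \<delta>"
    using G by auto
qed

lemma approximable_off_zero_determined:
  "integrable P f \<Longrightarrow> determined_off_zero f \<Longrightarrow> approximable_off_zero f"
  unfolding approximable_off_zero_def by (auto intro!: exI[of _ f])

text \<open>A pi-lambda argument: events that ignore a neighbourhood of 0 form a pi-system, which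
  generates because every count is the supremum of its counts off such neighbourhoods. Complements
  and disjoint unions stay in the L1 closure.\<close>

lemma approximable_off_zero_indicator:
  assumes "A \<in> sets P"
  shows "approximable_off_zero (indicator A)"
proof -
  define E where "E = {A \<in> sets P. \<exists>n. \<forall>\<omega>\<in>configurations. \<omega> \<in> A \<longleftrightarrow> \<omega> \<inter> off_zero n \<in> A}"
  have E_det: "determined_off_zero (indicator A)" if "A \<in> E" for A
    using that by (auto simp: E_def determined_off_zero_def indicator_def)
  have E_sets: "E \<subseteq> sets P" by (auto simp: E_def)
  have E_Pow: "E \<subseteq> Pow configurations"
  proof
    fix A assume "A \<in> E"
    then show "A \<in> Pow configurations" using E_sets sets.sets_into_space[of A P] by auto
  qed
  have stable: "Int_stable E"
  proof (rule Int_stableI)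
    fix A B assume AB: "A \<in> E" "B \<in> E"
    \<comment> \<open>The sum serves only to find one \<open>n\<close> that works for the
      intersection: a configuration lies in both events exactly when the sum is 2.\<close>
    have "determined_off_zero (\<lambda>\<omega>. indicator A \<omega> + indicator B \<omega>)"
      by (intro determined_off_zero_add E_det AB)
    then obtain n where n: "\<forall>\<omega>\<in>configurations. (indicator A \<omega> + indicator B \<omega> :: real)
        = indicator A (\<omega> \<inter> off_zero n) + indicator B (\<omega> \<inter> off_zero n)"
      by (auto simp: determined_off_zero_def)
    have "\<omega> \<in> A \<inter> B \<longleftrightarrow> \<omega> \<inter> off_zero n \<in> A \<inter> B" if "\<omega> \<in> configurations" for \<omega>
      using n[rule_format, OF that] by (auto simp: indicator_def of_bool_def split: if_splits)
    moreover have "A \<inter> B \<in> sets P" using AB E_sets by auto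
    ultimately show "A \<inter> B \<in> E" unfolding E_def by blast
  qed
  have "sets configuration_space \<subseteq> sets (sigma configurations E)"
  proof (rule sets_configuration_space_subset)
    show "space (sigma configurations E) = configurations" by (simp add: space_measure_of_conv)
    fix B :: "'a set" assume B: "B \<in> sets borel"
    have basic: "num_points (B \<inter> off_zero n) \<in> borel_measurable (sigma configurations E)" for n
    proof (rule measurableI)
      fix A :: "ennreal set" assume A[measurable]: "A \<in> sets borel"
      note B[measurable]
      have "{\<omega> \<in> space P. num_points (B \<inter> off_zero n) \<omega> \<in> A} \<in> sets P" by measurable
      moreover have "num_points (B \<inter> off_zero n) (\<omega> \<inter> off_zero n) = num_points (B \<inter> off_zero n) \<omega>" for \<omega>
        by (simp add: num_points_Int Int_commute Int_left_commute)
      ultimately have "{\<omega> \<in> space P. num_points (B \<inter> off_zero n) \<omega> \<in> A} \<in> E"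
        unfolding E_def mem_Collect_eq
        by (intro conjI exI[of _ n] ballI) (simp_all add: Int_off_zero_in_configurations)
      moreover have "num_points (B \<inter> off_zero n) -` A \<inter> configurations
          = {\<omega> \<in> space P. num_points (B \<inter> off_zero n) \<omega> \<in> A}" by auto
      ultimately show "num_points (B \<inter> off_zero n) -` A \<inter> space (sigma configurations E) \<in> sets (sigma configurations E)"
        using E_Pow by (simp add: space_measure_of_conv)
    qed auto
    \<comment> \<open>The sets \<open>B \<inter> off_zero n\<close> exhaust \<open>B\<close> except
      for the origin, which is never a point of a configuration.\<close>
    have "num_points B \<omega> = (SUP n. num_points (B \<inter> off_zero n) \<omega>)" if "\<omega> \<in> configurations" for \<omega>
    proof -
      have "(\<Union>n. B \<inter> off_zero n) = B - {0}"
      proof (intro equalityI subsetI)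
        fix y assume y: "y \<in> B - {0}"
        then obtain n where "inverse (real (Suc n)) < norm y"
          using reals_Archimedean[of "norm y"] by auto
        with y show "y \<in> (\<Union>n. B \<inter> off_zero n)" by (auto simp: off_zero_def)
      qed (auto simp: off_zero_def)
      moreover have "(\<omega> \<inter> (B - {0})) = \<omega> \<inter> B" using that by (auto simp: configurations_def)
      moreover have "incseq (\<lambda>n. B \<inter> off_zero n)"
        using off_zero_mono by (auto simp: incseq_def)
      ultimately show ?thesis using num_points_SUP[of "\<lambda>n. B \<inter> off_zero n" \<omega>] by (simp add: num_points_def)
    qed
    moreover have "(\<lambda>\<omega>. SUP n. num_points (B \<inter> off_zero n) \<omega>) \<in> borel_measurable (sigma configurations E)"
      by (intro borel_measurable_SUP basic) auto
    ultimately show "num_points B \<in> borel_measurable (sigma configurations E)"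
      by (subst measurable_cong) (auto simp: space_measure_of_conv)
  qed
  then have "A \<in> sigma_sets configurations E"
    using assms E_Pow by (auto simp: sets_P)
  from stable E_Pow this show ?thesis
  proof (induction rule: sigma_sets_induct_disjoint)
    case (basic A)
    then show ?case
      using E_sets by (intro approximable_off_zero_determined integrable_indicator_P E_det) auto
  next
    case empty
    show ?case by (intro approximable_off_zero_determined) (auto simp: determined_off_zero_def)
  next
    case (compl A)
    have "approximable_off_zero (\<lambda>\<omega>. (if \<omega> \<in> configurations then 1 else 0) + indicator A \<omega> * (-1))"
    proof (intro approximable_off_zero_add approximable_off_zero_scale compl approximable_off_zero_determined)
      show "integrable P (\<lambda>\<omega>. if \<omega> \<in> configurations then 1 else 0 :: real)"
      proof -
        have "integrable P (\<lambda>\<omega>. if \<omega> \<in> configurations then 1 else 0 :: real) \<longleftrightarrow> integrable P (\<lambda>_. 1 :: real)"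
          by (rule Bochner_Integration.integrable_cong) auto
        then show ?thesis by simp
      qed
    qed (auto simp: determined_off_zero_def Int_off_zero_in_configurations)
    moreover have "A \<subseteq> configurations"
      using compl(1) sigma_sets_into_sp[OF E_Pow] by auto
    ultimately show ?case
      by (elim back_subst[where P = approximable_off_zero]) (auto simp: indicator_def fun_eq_iff)
  next
    case (union A)
    have sets: "A i \<in> sets P" for i
      using union(2) sets.sigma_sets_subset[OF E_sets] by auto
    show ?case
    proof (rule approximable_off_zero_limit[where s = "\<lambda>k \<omega>. \<Sum>i<k. indicator (A i) \<omega>"])
      show "approximable_off_zero (\<lambda>\<omega>. \<Sum>i<k. indicator (A i) \<omega>)" for k
      proof (induction k)
        case 0
        show ?case by (intro approximable_off_zero_determined) (auto simp: determined_off_zero_def)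
      next
        case (Suc k)
        then show ?case by (simp add: approximable_off_zero_add union)
      qed
      show "integrable P (indicat_real (\<Union> (range A)))"
        using sets by (intro integrable_indicator_P) auto
      fix \<omega>
      have eq: "(\<Sum>i<k. indicator (A i) \<omega>) = indicat_real (\<Union>i<k. A i) \<omega>" for k
        using union(1) by (intro indicator_UN_disjoint[symmetric]) (auto simp: disjoint_family_on_def)
      show "(\<lambda>k. \<Sum>i<k. indicator (A i) \<omega>) \<longlonglongrightarrow> indicat_real (\<Union> (range A)) \<omega>"
        unfolding eq by (rule LIMSEQ_indicator_UN)
      show "\<bar>\<Sum>i<k. indicator (A i) \<omega>\<bar> \<le> 2 * \<bar>indicat_real (\<Union> (range A)) \<omega>\<bar>" for k
        unfolding eq by (auto simp: indicator_def)
    qed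
  qed
qed

lemma approximable_off_zero_integrable:
  assumes "integrable P f"
  shows "approximable_off_zero f"
  using assms
proof (induction rule: integrable_induct)
  case (base A c)
  then show ?case by (simp add: approximable_off_zero_scale approximable_off_zero_indicator)
next
  case (add f g)
  then show ?case by (simp add: approximable_off_zero_add)
next
  case (lim f s)
  then show ?case by (intro approximable_off_zero_limit[of s f]) auto
qed

text \<open>By Kolmogorov's zero-one law, conditioning on ever smaller neighbourhoods of \<open>0\<close> leaves
  only the mean.\<close>
lemma resample_mean_tendsto:
  assumes F: "F \<in> borel_measurable P" and M: "\<And>\<omega>. \<omega> \<in> configurations \<Longrightarrow> \<bar>F \<omega>\<bar> \<le> M"
  shows "(\<lambda>m. \<integral>\<omega>. \<bar>resample_mean (off_zero m) F \<omega> - (\<integral>\<omega>. F \<omega> \<partial>P)\<bar> \<partial>P) \<longlonglongrightarrow> 0"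
proof (rule LIMSEQ_I)
  fix \<delta> :: real assume "\<delta> > 0"
  then have "\<delta> / 2 > 0" by simp
  have Fi: "integrable P F" by (rule integrable_bounded[OF F M])
  obtain G where G: "integrable P G" "determined_off_zero G" "(\<integral>\<omega>. \<bar>F \<omega> - G \<omega>\<bar> \<partial>P) < \<delta> / 2"
    using approximable_off_zero_integrable[OF Fi] \<open>\<delta> / 2 > 0\<close> unfolding approximable_off_zero_def by meson
  obtain n where n: "\<forall>\<omega>\<in>configurations. G \<omega> = G (\<omega> \<inter> off_zero n)"
    using G(2) by (auto simp: determined_off_zero_def)
  let ?H = "\<lambda>\<omega>. \<bar>F \<omega> - G \<omega>\<bar>"
  have Hi: "integrable P ?H" using Fi G by simp
  have "(\<integral>\<omega>. \<bar>resample_mean (off_zero m) F \<omega> - (\<integral>\<omega>. F \<omega> \<partial>P)\<bar> \<partial>P) < \<delta>" if m: "m \<ge> n" for m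
  proof -
    \<comment> \<open>For \<open>m \<ge> n\<close> the resampling replaces everything that
      \<open>G\<close> can see, so the conditional mean of \<open>G\<close> is the constant mean of
      \<open>G\<close>. The whole error is then at most twice the L1 distance of \<open>F\<close>
      and \<open>G\<close>.\<close>
    have GR: "G (resample (off_zero m) \<omega> \<omega>') = G \<omega>'" if "\<omega> \<in> configurations" "\<omega>' \<in> configurations" for \<omega> \<omega>'
    proof -
      have "resample (off_zero m) \<omega> \<omega>' \<inter> off_zero m = \<omega>' \<inter> off_zero m"
        by (auto simp: resample_def)
      then show ?thesis
        using determined_off_zero_mono[OF n m] that resample_in_configurations[OF that] by metis
    qed
    have pw: "\<bar>resample_mean (off_zero m) F \<omega> - (\<integral>\<omega>. F \<omega> \<partial>P)\<bar> \<le> resample_mean (off_zero m) ?H \<omega> + (\<integral>\<omega>. ?H \<omega> \<partial>P)"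
      if \<omega>: "\<omega> \<in> configurations" for \<omega>
    proof -
      have iF: "integrable P (\<lambda>\<omega>'. F (resample (off_zero m) \<omega> \<omega>'))"
        by (rule integrable_resample[OF off_zero_borel F M \<omega>])
      have Geq: "integrable P (\<lambda>\<omega>'. G (resample (off_zero m) \<omega> \<omega>')) \<longleftrightarrow> integrable P G"
        by (rule Bochner_Integration.integrable_cong) (use GR \<omega> in auto)
      have GI: "(\<integral>\<omega>'. G (resample (off_zero m) \<omega> \<omega>') \<partial>P) = (\<integral>\<omega>. G \<omega> \<partial>P)"
        by (rule Bochner_Integration.integral_cong) (use GR \<omega> in auto)
      have "\<bar>resample_mean (off_zero m) F \<omega> - (\<integral>\<omega>. G \<omega> \<partial>P)\<bar>
          = \<bar>\<integral>\<omega>'. F (resample (off_zero m) \<omega> \<omega>') - G (resample (off_zero m) \<omega> \<omega>') \<partial>P\<bar>"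
        using iF Geq G(1) by (simp add: resample_mean_def GI)
      also have "\<dots> \<le> resample_mean (off_zero m) ?H \<omega>"
        unfolding resample_mean_def by (rule integral_abs_bound)
      finally have 1: "\<bar>resample_mean (off_zero m) F \<omega> - (\<integral>\<omega>. G \<omega> \<partial>P)\<bar> \<le> resample_mean (off_zero m) ?H \<omega>" .
      have "\<bar>(\<integral>\<omega>. F \<omega> \<partial>P) - (\<integral>\<omega>. G \<omega> \<partial>P)\<bar> = \<bar>\<integral>\<omega>. F \<omega> - G \<omega> \<partial>P\<bar>" using Fi G(1) by simp
      also have "\<dots> \<le> (\<integral>\<omega>. ?H \<omega> \<partial>P)" by (rule integral_abs_bound)
      finally show ?thesis using 1 by linarith
    qed
    have "(\<integral>\<omega>. \<bar>resample_mean (off_zero m) F \<omega> - (\<integral>\<omega>. F \<omega> \<partial>P)\<bar> \<partial>P)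
        \<le> (\<integral>\<omega>. resample_mean (off_zero m) ?H \<omega> + (\<integral>\<omega>. ?H \<omega> \<partial>P) \<partial>P)"
      using pw integrable_resample_mean[OF off_zero_borel Fi] integrable_resample_mean[OF off_zero_borel Hi]
      by (intro integral_mono) auto
    also have "\<dots> = 2 * (\<integral>\<omega>. ?H \<omega> \<partial>P)"
      using integrable_resample_mean[OF off_zero_borel Hi] integral_resample_mean[OF off_zero_borel Hi] by simp
    finally show ?thesis using G(3) by simp
  qed
  then show "\<exists>n. \<forall>m\<ge>n. norm ((\<integral>\<omega>. \<bar>resample_mean (off_zero m) F \<omega> - (\<integral>\<omega>. F \<omega> \<partial>P)\<bar> \<partial>P) - 0) < \<delta>"
    by (intro exI[of _ n]) (auto simp: abs_of_nonneg)
qed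

text \<open>L1 convergence of the conditional means is enough for their exponential moments: by the
  tangent inequality exp(a) \<le> exp(b) + exp(a)(a - b), and exp(a) is at most
  \<open>exp (t * M)\<close>.\<close>

lemma exp_moment_limit:
  assumes F: "F \<in> borel_measurable P" and M: "\<And>\<omega>. \<omega> \<in> configurations \<Longrightarrow> \<bar>F \<omega>\<bar> \<le> M"
    and t: "t \<ge> 0"
    and le: "\<And>m. m \<ge> m0 \<Longrightarrow> a \<le> exp K * (\<integral>\<omega>. exp (t * resample_mean (off_zero m) F \<omega>) \<partial>P)"
  shows "a \<le> exp K * exp (t * (\<integral>\<omega>. F \<omega> \<partial>P))"
proof -
  let ?e = "\<integral>\<omega>. F \<omega> \<partial>P"
  let ?d = "\<lambda>m. \<integral>\<omega>. \<bar>resample_mean (off_zero m) F \<omega> - ?e\<bar> \<partial>P"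
  have Fi: "integrable P F" by (rule integrable_bounded[OF F M])
  have "a \<le> exp K * (exp (t * ?e) + exp (t * M) * (t * ?d m))" if m: "m \<ge> m0" for m
  proof -
    let ?T = "resample_mean (off_zero m) F"
    have Ti: "integrable P ?T" by (rule integrable_resample_mean[OF off_zero_borel Fi])
    have Tb: "\<bar>?T \<omega>\<bar> \<le> M" if "\<omega> \<in> configurations" for \<omega>
      by (rule abs_resample_mean_le[OF off_zero_borel F M that])
    have "exp (t * ?T \<omega>) \<le> exp (t * ?e) + exp (t * M) * (t * \<bar>?T \<omega> - ?e\<bar>)" if "\<omega> \<in> configurations" for \<omega>
    proof -
      have "exp (t * ?T \<omega>) * (1 + (t * ?e - t * ?T \<omega>)) \<le> exp (t * ?T \<omega>) * exp (t * ?e - t * ?T \<omega>)"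
        by (intro mult_left_mono exp_ge_add_one_self) auto
      also have "\<dots> = exp (t * ?e)" by (simp add: exp_add[symmetric])
      finally have "exp (t * ?T \<omega>) \<le> exp (t * ?e) + exp (t * ?T \<omega>) * (t * (?T \<omega> - ?e))"
        by (simp add: algebra_simps)
      also have "exp (t * ?T \<omega>) * (t * (?T \<omega> - ?e)) \<le> exp (t * M) * (t * \<bar>?T \<omega> - ?e\<bar>)"
        using Tb[OF that] t
        by (intro order_trans[OF mult_left_mono mult_right_mono]) (auto intro!: mult_left_mono)
      finally show ?thesis by simp
    qed
    then have "(\<integral>\<omega>. exp (t * ?T \<omega>) \<partial>P) \<le> (\<integral>\<omega>. exp (t * ?e) + exp (t * M) * (t * \<bar>?T \<omega> - ?e\<bar>) \<partial>P)"
    proof (intro integral_mono)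
      show "integrable P (\<lambda>\<omega>. exp (t * ?T \<omega>))"
      proof (rule integrable_bounded)
        show "(\<lambda>\<omega>. exp (t * ?T \<omega>)) \<in> borel_measurable P"
          using Ti by (intro measurable_compose[OF borel_measurable_times[OF borel_measurable_const] borel_measurable_exp]) auto
        show "\<bar>exp (t * ?T \<omega>)\<bar> \<le> exp (t * M)" if "\<omega> \<in> configurations" for \<omega>
          using Tb[OF that] t by (auto intro!: mult_left_mono)
      qed
    qed (use Ti in auto)
    also have "\<dots> = exp (t * ?e) + exp (t * M) * (t * ?d m)" using Ti by simp
    finally have "exp K * (\<integral>\<omega>. exp (t * ?T \<omega>) \<partial>P) \<le> exp K * (exp (t * ?e) + exp (t * M) * (t * ?d m))"
      by (intro mult_left_mono) auto
    with le[OF m] show ?thesis by linarith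
  qed
  note ub = this
  have "(\<lambda>m. exp K * (exp (t * ?e) + exp (t * M) * (t * ?d m)))
      \<longlonglongrightarrow> exp K * (exp (t * ?e) + exp (t * M) * (t * 0))"
    by (intro tendsto_intros resample_mean_tendsto[OF F M])
  from LIMSEQ_le_const[OF this, of a] have "a \<le> exp K * (exp (t * ?e) + exp (t * M) * (t * 0))"
    using ub by blast
  then show ?thesis by simp
qed

end

subsection \<open>Elementary estimates\<close>

text \<open>In the Taylor tail from degree 3 on, x^(n+3) \<le> x^3 because x \<le> 1. The quadratic
  term is kept apart since it is the only one whose integral against x^(-1-\<alpha>) diverges as
  \<alpha> tends to 2; the factor exp(u) goes with x^3.\<close>

lemma exp_remainder_le:
  fixes u x :: real
  assumes "0 \<le> u" "0 \<le> x" "x \<le> 1"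
  shows "exp (u * x) - 1 - u * x \<le> u\<^sup>2 / 2 * x\<^sup>2 + exp u * x ^ 3"
proof -
  have sm: "summable (\<lambda>n. inverse (fact (n + 3)) * y ^ (n + 3))" for y :: real
    using summable_exp[of y] by (subst summable_iff_shift)
  have eq: "(\<Sum>n. inverse (fact (n + 3)) * y ^ (n + 3)) = exp y - 1 - y - y\<^sup>2 / 2" for y :: real
    using suminf_minus_initial_segment[OF summable_exp[of y], of 3]
    by (simp add: exp_def scaleR_conv_of_real numeral_3_eq_3 numeral_2_eq_2 divide_simps)
  have "exp (u * x) - 1 - u * x - (u * x)\<^sup>2 / 2 \<le> x ^ 3 * (exp u - 1 - u - u\<^sup>2 / 2)"
    unfolding eq[symmetric] suminf_mult[OF sm, symmetric]
  proof (rule suminf_le[OF _ sm summable_mult[OF sm]])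
    fix n
    have "x ^ (n + 3) \<le> x ^ 3"
      using assms by (intro power_decreasing) auto
    then have "inverse (fact (n + 3)) * u ^ (n + 3) * x ^ (n + 3) \<le> inverse (fact (n + 3)) * u ^ (n + 3) * x ^ 3"
      using assms by (intro mult_left_mono) auto
    then show "inverse (fact (n + 3)) * (u * x) ^ (n + 3) \<le> x ^ 3 * (inverse (fact (n + 3)) * u ^ (n + 3))"
      by (simp add: power_mult_distrib mult_ac)
  qed
  also have "\<dots> \<le> x ^ 3 * exp u"
  proof (rule mult_left_mono)
    have "0 \<le> u + u\<^sup>2 / 2" using assms by simp
    then show "exp u - 1 - u - u\<^sup>2 / 2 \<le> exp u" by linarith
  qed (use assms in simp)
  finally show ?thesis by (simp add: power_mult_distrib mult_ac)
qed

lemma geometric_sum_le: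
  assumes "h > 0" "\<gamma> > (0 :: real)"
  shows "(\<Sum>i<n. exp (- (\<gamma> * h * real i))) \<le> 1 / (1 - exp (- (\<gamma> * h)))"
proof -
  have "exp (- (\<gamma> * h * real i)) = exp (- (\<gamma> * h)) ^ i" for i
    by (simp add: exp_of_nat_mult[symmetric] mult_ac)
  moreover have "exp (- (\<gamma> * h)) < 1" using assms by simp
  ultimately show ?thesis
    using sum_le_suminf[OF summable_geometric, of "exp (- (\<gamma> * h))" "{..<n}"]
    by (simp add: suminf_geometric)
qed

text \<open>Up to the factor s, the ratio is the upper sum over all shells of ratio exp(-D/n) for
  the integral of x^(\<gamma>-1) over (0,1), which equals 1/\<gamma>.\<close>

lemma geometric_ratio_tendsto:
  fixes \<alpha> \<gamma> :: real
  assumes "\<alpha> > 0" "\<gamma> > 0" "D > 0"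
  shows "(\<lambda>n. (exp (\<alpha> * (D / real n)) - 1) / (\<alpha> * (1 - exp (- (\<gamma> * (D / real n)))))) \<longlonglongrightarrow> 1 / \<gamma>"
  using assms by (real_asymp simp: field_simps)

text \<open>For \<alpha> \<le> 1 the bound -s ln s \<le> 1 already suffices. Otherwise ln(y)/y
  decreases for y \<ge> e, so y = 1/s may be lowered to the constant \<open>K1\<close> of the
  hypothesis.\<close>

lemma neg_mult_ln_le:
  fixes s \<alpha> :: real
  assumes \<alpha>: "0 < \<alpha>" "\<alpha> < 2" and s: "0 < s"
    and K: "3 / 2 * (1 + 4 / (2 - \<alpha>) * ln (2 / (2 - \<alpha>))) * ln (1 + 8 / (2 - \<alpha>) * ln (2 / (2 - \<alpha>))) \<le> 1 / s"
  shows "s * - ln s \<le> 2 * (2 - \<alpha>)"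
proof (cases "2 - \<alpha> \<ge> 1")
  case True
  have "- ln s = ln (1 / s)" using s by (simp add: ln_div)
  also have "\<dots> \<le> 1 / s" using s ln_le_minus_one[of "1 / s"] by simp
  finally have "s * - ln s \<le> s * (1 / s)" using s by (intro mult_left_mono) auto
  then show ?thesis using s True by simp
next
  case False
  define e where "e = 2 - \<alpha>"
  define L where "L = ln (2 / e)"
  define b where "b = 2 / e * L"
  have e: "0 < e" "e < 1" using False \<alpha> by (auto simp: e_def)
  have "2 \<le> 2 / e" using e by (simp add: field_simps)
  then have "ln 2 \<le> L" unfolding L_def using e by (subst ln_le_cancel_iff) auto
  then have L: "L \<ge> 2 / 3" using ln2_ge_two_thirds by linarith
  have "2 * L \<le> b" unfolding b_def using \<open>2 \<le> 2 / e\<close> L by (intro mult_right_mono) auto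
  then have b: "b \<ge> 4 / 3" using L by simp
  have e3: "exp (1 :: real) \<le> 3" by (rule exp_le)
  define l where "l = ln (1 + 4 * b)"
  have "ln (exp 1) \<le> l" unfolding l_def using b e3 by (subst ln_le_cancel_iff) auto
  then have l1: "l \<ge> 1" by simp
  define K1 where "K1 = 3 / 2 * (1 + 2 * b) * l"
  have K1s: "K1 \<le> 1 / s" using K by (simp add: K1_def l_def b_def L_def e_def)
  have "3 \<le> 3 / 2 * (1 + 2 * b) * 1" using b by simp
  also have "\<dots> \<le> K1" unfolding K1_def using b l1 by (intro mult_left_mono) auto
  finally have K13: "3 \<le> K1" .
  have "ln (1 / s) / (1 / s) \<le> ln K1 / K1"
    by (rule ln_x_over_x_mono) (use e3 K13 K1s in auto)
  then have "s * - ln s \<le> ln K1 / K1" using s by (simp add: ln_div mult.commute)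
  \<comment> \<open>Taking logarithms of the three factors of \<open>K1\<close> costs 1/2,
    \<open>l\<close> and \<open>l - 1\<close>. Dividing by \<open>K1\<close> then cancels
    \<open>l\<close> and leaves about 2/(3b), which is at most \<open>e\<close> by the choice b =
    2L/e and L \<ge> 2/3.\<close>
  also have "ln K1 \<le> 2 * l"
  proof -
    have "ln K1 = ln (3 / 2) + ln (1 + 2 * b) + ln l"
    proof -
      have "ln K1 = ln (3 / 2 * (1 + 2 * b)) + ln l"
        unfolding K1_def by (rule ln_mult_pos) (use b l1 in auto)
      also have "ln (3 / 2 * (1 + 2 * b)) = ln (3 / 2) + ln (1 + 2 * b)"
        by (rule ln_mult_pos) (use b in auto)
      finally show ?thesis .
    qed
    moreover have "ln (3 / 2 :: real) \<le> 3 / 2 - 1" by (rule ln_le_minus_one) simp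
    moreover have "ln (1 + 2 * b) \<le> l" unfolding l_def using b by (subst ln_le_cancel_iff) auto
    moreover have "ln l \<le> l - 1" using l1 by (intro ln_le_minus_one) simp
    ultimately show ?thesis by simp
  qed
  also have "2 * l / K1 = 4 / (3 * (1 + 2 * b))"
  proof -
    have "2 * l = 4 / (3 * (1 + 2 * b)) * K1" using b by (simp add: K1_def field_simps)
    then show ?thesis using K13 by simp
  qed
  also have "\<dots> \<le> 4 / (3 * (2 * b))" using b by (intro divide_left_mono) auto
  also have "\<dots> = e / (3 * L)" using e L by (simp add: b_def field_simps)
  also have "\<dots> \<le> e / 1" using e L by (intro divide_left_mono) auto
  also have "\<dots> \<le> 2 * (2 - \<alpha>)" using e by (simp add: e_def)
  finally show ?thesis using K13 by (simp add: divide_right_mono)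
qed

text \<open>With u = -ln s one has s exp(u) = 1, and \<open>neg_mult_ln_le\<close> gives s u^2 /
  (2(2-\<alpha>)) \<le> u. The exponent is thus at most 1 - u, which yields e s; the last step
  enlarges this to the constant 3e^2/2 of the theorem.\<close>

lemma deviation_bound_le:
  fixes s \<alpha> :: real
  assumes \<alpha>: "0 < \<alpha>" "\<alpha> < 2" and s: "0 < s" "s < 1"
    and K: "3 / 2 * (1 + 4 / (2 - \<alpha>) * ln (2 / (2 - \<alpha>))) * ln (1 + 8 / (2 - \<alpha>) * ln (2 / (2 - \<alpha>))) \<le> 1 / s"
  shows "exp (s * ((- ln s)\<^sup>2 / (2 * (2 - \<alpha>)) + exp (- ln s)) - 2 * - ln s) \<le> 3 / 2 * (exp 1)\<^sup>2 * s"
proof -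
  define u where "u = - ln s"
  have u: "u \<ge> 0" using s by (simp add: u_def)
  have eu: "s * exp u = 1" using s by (simp add: u_def exp_minus)
  have "s * u \<le> 2 * (2 - \<alpha>)" unfolding u_def by (rule neg_mult_ln_le[OF \<alpha> s(1) K])
  then have "s * u * u \<le> 2 * (2 - \<alpha>) * u" using u by (rule mult_right_mono)
  then have "s * (u\<^sup>2 / (2 * (2 - \<alpha>))) \<le> u" using \<alpha> by (simp add: field_simps power2_eq_square)
  then have "s * (u\<^sup>2 / (2 * (2 - \<alpha>)) + exp u) - 2 * u \<le> 1 - u"
    using eu by (simp add: distrib_left)
  then have "exp (s * (u\<^sup>2 / (2 * (2 - \<alpha>)) + exp u) - 2 * u) \<le> exp (1 - u)" by simp
  also have "\<dots> = exp 1 * s" using s by (simp add: exp_add u_def)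
  also have "\<dots> \<le> 3 / 2 * (exp 1)\<^sup>2 * s"
  proof (rule mult_right_mono)
    have "exp 1 * 1 \<le> exp 1 * (exp 1 * (3 / 2 :: real))"
      using exp_ge_add_one_self[of 1] by (intro mult_left_mono) auto
    then show "exp 1 \<le> 3 / 2 * (exp 1 :: real)\<^sup>2" by (simp add: power2_eq_square)
  qed (use s in simp)
  finally show ?thesis by (simp add: u_def)
qed

subsection \<open>Stable intensities\<close>

context poisson_process
begin

text \<open>Fubini on the product hypothesis puts the configuration outermost. Joint measurability
  of inserting a point permits the swap to the order in which the shell argument needs the two
  quantifiers.\<close>

lemma lipschitz_differenceI:
  assumes F: "F \<in> borel_measurable P"
    and AE: "AE (\<omega>, y) in P \<Otimes>\<^sub>M \<nu>. \<bar>difference y F \<omega>\<bar> \<le> c * norm y"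
  shows "lipschitz_difference c F"
proof -
  interpret nu: sigma_finite_measure \<nu> by (rule sigma_finite_intensity)
  interpret PN: pair_sigma_finite P \<nu> ..
  have "AE p in P \<Otimes>\<^sub>M \<nu>. \<bar>F (add_point (snd p) (fst p)) - F (fst p)\<bar> \<le> c * norm (snd p)"
    using AE by eventually_elim (auto simp: difference_def add_point_def)
  from PN.AE_pair[OF this]
  have "AE \<omega> in P. AE y in \<nu>. \<bar>F (add_point y \<omega>) - F \<omega>\<bar> \<le> c * norm y" by simp
  then show ?thesis
    unfolding lipschitz_difference_def
    using PN.AE_commute[of "\<lambda>\<omega> y. \<bar>F (add_point y \<omega>) - F \<omega>\<bar> \<le> c * norm y"]
      measurable_difference[OF F measurable_ident, of c] by simp
qed

lemma lipschitz_difference_restrict: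
  assumes "lipschitz_difference c F" "S \<in> sets borel" "emeasure \<nu> S < \<infinity>" "c \<ge> 0"
  shows "lipschitz_difference c (\<lambda>\<omega>. F (\<omega> - S))"
  unfolding lipschitz_difference_def
  using lipschitz_difference_Diff[OF assms(1-3)]
proof (rule eventually_mono)
  fix y assume *: "AE \<omega> in P. \<bar>F (add_point y (\<omega> - S)) - F (\<omega> - S)\<bar> \<le> c * norm y"
  show "AE \<omega> in P. \<bar>F (add_point y \<omega> - S) - F (\<omega> - S)\<bar> \<le> c * norm y"
  proof (cases "y \<in> S")
    case True
    then have "add_point y \<omega> - S = \<omega> - S" for \<omega> by (auto simp: add_point_def)
    then show ?thesis using assms(4) by simp
  next
    case False
    then have "add_point y \<omega> - S = add_point y (\<omega> - S)" for \<omega> by (auto simp: add_point_def)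
    then show ?thesis using * by simp
  qed
qed

lemma lipschitz_difference_clamp:
  assumes "lipschitz_difference c F"
  shows "lipschitz_difference c (\<lambda>\<omega>. max a (min b (F \<omega>)))"
  using assms unfolding lipschitz_difference_def
proof (rule eventually_mono)
  fix y assume "AE \<omega> in P. \<bar>F (add_point y \<omega>) - F \<omega>\<bar> \<le> c * norm y"
  then show "AE \<omega> in P. \<bar>max a (min b (F (add_point y \<omega>))) - max a (min b (F \<omega>))\<bar> \<le> c * norm y"
    by eventually_elim (auto simp: max_def min_def)
qed

lemma lipschitz_difference_uminus:
  "lipschitz_difference c F \<Longrightarrow> lipschitz_difference c (\<lambda>\<omega>. - F \<omega>)"
  unfolding lipschitz_difference_def by (simp add: abs_minus_commute)

lemma exponential_Markov:
  assumes F: "F \<in> borel_measurable P" and M: "\<And>\<omega>. \<omega> \<in> configurations \<Longrightarrow> \<bar>F \<omega>\<bar> \<le> M"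
    and t: "t > 0"
  shows "prob {\<omega> \<in> configurations. F \<omega> \<ge> a} \<le> exp (- t * a) * (\<integral>\<omega>. exp (t * F \<omega>) \<partial>P)"
proof -
  let ?A = "{\<omega> \<in> configurations. F \<omega> \<ge> a}"
  note F[measurable]
  have A: "?A \<in> sets P"
  proof -
    have "{\<omega> \<in> space P. F \<omega> \<ge> a} \<in> sets P" by measurable
    then show ?thesis by simp
  qed
  have "?A \<inter> space P = ?A" by auto
  then have "prob ?A = (\<integral>\<omega>. indicator ?A \<omega> \<partial>P)"
    by (simp only: Bochner_Integration.integral_indicator)
  also have "\<dots> \<le> (\<integral>\<omega>. exp (- t * a) * exp (t * F \<omega>) \<partial>P)"
  proof (rule integral_mono)
    have "integrable P (\<lambda>\<omega>. exp (t * F \<omega>))"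
    proof (rule integrable_bounded)
      show "\<bar>exp (t * F \<omega>)\<bar> \<le> exp (t * M)" if "\<omega> \<in> configurations" for \<omega>
        using M[OF that] t by (simp add: abs_le_iff)
    qed measurable
    then show "integrable P (\<lambda>\<omega>. exp (- t * a) * exp (t * F \<omega>))" by simp
    show "indicator ?A \<omega> \<le> exp (- t * a) * exp (t * F \<omega>)" for \<omega>
      using t by (auto simp: indicator_def exp_add[symmetric] intro!: mult_left_mono)
  qed (rule integrable_indicator_P[OF A])
  finally show ?thesis by simp
qed

end

section \<open>The stable intensity: masses of shells and exponential moments\<close>

locale stable_process =
  fixes \<alpha> :: real and \<sigma> :: "'a::euclidean_space measure" and P :: "'a set measure"
  assumes \<alpha>: "0 < \<alpha>" "\<alpha> < 2"
    and finite_spherical: "finite_measure \<sigma>"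
    and sets_spherical: "sets \<sigma> = sets (restrict_space borel (sphere 0 1))"
    and poisson: "poisson_measure (stable_levy_measure \<alpha> \<sigma>) P"
begin

abbreviation \<nu> :: "'a measure" where "\<nu> \<equiv> stable_levy_measure \<alpha> \<sigma>"

definition far :: "real \<Rightarrow> 'a set" where "far a = {y. a < norm y}"

lemma far_borel [measurable]: "far a \<in> sets borel"
  unfolding far_def by (intro borel_open open_Collect_less continuous_intros)

lemma space_spherical: "space \<sigma> = sphere 0 1"
  using sets_eq_imp_space_eq[OF sets_spherical] by (simp add: space_restrict_space)

lemma emeasure_far:
  assumes a: "a > 0"
  shows "emeasure \<nu> (far a) = ennreal (measure \<sigma> (sphere 0 1) * a powr - \<alpha> / \<alpha>)"
proof -
  interpret sigma: finite_measure \<sigma> by (rule finite_spherical)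
  have inner: "(\<integral>\<^sup>+r\<in>{0<..}. indicator (far a) (r *\<^sub>R \<xi>) * ennreal (r powr (-1 - \<alpha>)) \<partial>lborel) = ennreal (a powr - \<alpha> / \<alpha>)"
    if "\<xi> \<in> space \<sigma>" for \<xi>
  proof -
    have \<xi>: "norm \<xi> = 1" using that by (simp add: space_spherical)
    have "(\<integral>\<^sup>+r\<in>{0<..}. indicator (far a) (r *\<^sub>R \<xi>) * ennreal (r powr (-1 - \<alpha>)) \<partial>lborel)
        = (\<integral>\<^sup>+r. ennreal (r powr (-1 - \<alpha>)) * indicator {a..} r \<partial>lborel)"
    \<comment> \<open>On a ray with direction of norm 1 the set \<open>far a\<close> is the open
      half-line beyond \<open>a\<close>; it is closed up at the single radius \<open>a\<close> so
      that the fundamental theorem applies.\<close>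
    proof (rule nn_integral_cong_AE)
      show "AE r in lborel. indicator (far a) (r *\<^sub>R \<xi>) * ennreal (r powr (-1 - \<alpha>)) * indicator {0<..} r
          = ennreal (r powr (-1 - \<alpha>)) * indicator {a..} r"
        using AE_lborel_singleton[of a]
        by eventually_elim (use a \<xi> in \<open>auto simp: far_def indicator_def\<close>)
    qed
    also have "\<dots> = ennreal (0 - - (a powr - \<alpha> / \<alpha>))"
    proof (rule nn_integral_FTC_atLeast)
      show "((\<lambda>r. - (r powr - \<alpha> / \<alpha>)) \<longlongrightarrow> 0) at_top"
        using \<alpha> by real_asymp
      show "((\<lambda>r. - (r powr - \<alpha> / \<alpha>)) has_real_derivative r powr (-1 - \<alpha>)) (at r)" if "a \<le> r" for r
        using that a \<alpha> by (auto intro!: derivative_eq_intros simp: field_simps powr_diff powr_minus)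
    qed auto
    finally show ?thesis by simp
  qed
  have "emeasure \<nu> (far a) = (\<integral>\<^sup>+\<xi>. ennreal (a powr - \<alpha> / \<alpha>) \<partial>\<sigma>)"
    unfolding emeasure_stable_levy_measure[OF sets_spherical far_borel]
    by (rule nn_integral_cong) (rule inner)
  also have "\<dots> = ennreal (measure \<sigma> (sphere 0 1) * a powr - \<alpha> / \<alpha>)"
    using \<alpha> by (simp add: space_spherical sigma.emeasure_eq_measure ennreal_mult'[symmetric] mult.commute)
  finally show ?thesis .
qed

lemma emeasure_zero: "emeasure \<nu> {0} = 0"
proof -
  have inner: "(\<integral>\<^sup>+r\<in>{0<..}. indicator {0} (r *\<^sub>R \<xi>) * ennreal (r powr (-1 - \<alpha>)) \<partial>lborel) = (\<integral>\<^sup>+(r::real). 0 \<partial>lborel)"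
    if "\<xi> \<in> space \<sigma>" for \<xi>
    by (rule nn_integral_cong) (use that in \<open>auto simp: indicator_def space_spherical\<close>)
  have "emeasure \<nu> {0} = (\<integral>\<^sup>+\<xi>. (\<integral>\<^sup>+(r::real). 0 \<partial>lborel) \<partial>\<sigma>)"
    unfolding emeasure_stable_levy_measure[OF sets_spherical borel_singleton[OF sets.empty_sets]]
    by (rule nn_integral_cong) (rule inner)
  then show ?thesis by simp
qed

lemma sigma_finite_levy: "sigma_finite_measure \<nu>"
proof
  let ?A = "insert {0} (range (\<lambda>n. far (inverse (real (Suc n)))))"
  have "x \<in> \<Union>?A" for x
  proof (cases "x = 0")
    case False
    then obtain n where "inverse (real (Suc n)) < norm x" using reals_Archimedean[of "norm x"] by auto
    then show ?thesis by (auto simp: far_def)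
  qed auto
  then have "\<Union>?A = space \<nu>" by auto
  moreover have "\<forall>a\<in>?A. emeasure \<nu> a \<noteq> \<infinity>"
    by (auto simp: emeasure_zero emeasure_far simp del: of_nat_Suc)
  moreover have "?A \<subseteq> sets \<nu>" by auto
  moreover have "countable ?A" by auto
  ultimately show "\<exists>A. countable A \<and> A \<subseteq> sets \<nu> \<and> \<Union> A = space \<nu> \<and> (\<forall>a\<in>A. emeasure \<nu> a \<noteq> \<infinity>)"
    by blast
qed

sublocale poisson_process "stable_levy_measure \<alpha> \<sigma>" P
  by (rule poisson_process.intro[OF poisson _ sigma_finite_levy]) simp

lemma measure_far: "a > 0 \<Longrightarrow> measure \<nu> (far a) = measure \<sigma> (sphere 0 1) * a powr - \<alpha> / \<alpha>"
  using \<alpha> by (simp add: measure_def emeasure_far)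

lemma emeasure_far_finite: "a > 0 \<Longrightarrow> emeasure \<nu> (far a) < \<infinity>"
  by (simp add: emeasure_far)

lemma measure_shell:
  assumes "0 < a" "a \<le> b"
  shows "measure \<nu> (far a - far b) = measure \<sigma> (sphere 0 1) / \<alpha> * (a powr - \<alpha> - b powr - \<alpha>)"
proof -
  have "far b \<subseteq> far a" using assms by (auto simp: far_def)
  then have "measure \<nu> (far a - far b) = measure \<nu> (far a) - measure \<nu> (far b)"
    using emeasure_far_finite[of a] assms by (intro measure_Diff) auto
  then show ?thesis using assms by (simp add: measure_far right_diff_distrib diff_divide_distrib)
qed

text \<open>Radii in geometric progression make both the shell masses and the powers of the radii
  geometric, so the costs sum in closed form and are bounded by full geometric series.
  \<open>\<Lambda>\<close> bounds the mass of every shell, the innermost being the heaviest.\<close>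

lemma exp_moment_le_shells:
  fixes N :: nat
  assumes F: "F \<in> borel_measurable P" and M: "\<And>\<omega>. \<omega> \<in> configurations \<Longrightarrow> \<bar>F \<omega>\<bar> \<le> M"
    and lip: "lipschitz_difference c F" "c > 0"
    and R: "R > 0" and u: "u > 0" and D: "D > 0" and N: "N > 0"
  defines "s \<equiv> measure \<sigma> (sphere 0 1) * R powr - \<alpha>" and "t \<equiv> u / (c * R)" and "h \<equiv> D / real N"
  defines "\<Lambda> \<equiv> s / \<alpha> * exp (\<alpha> * D) * (exp (\<alpha> * h) - 1)"
  shows "(\<integral>\<omega>. exp (t * F \<omega>) \<partial>P) \<le>
    exp (exp (2 * t * M * \<Lambda>) * (s * (u\<^sup>2 / 2 * ((exp (\<alpha> * h) - 1) / (\<alpha> * (1 - exp (- ((2 - \<alpha>) * h)))))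
        + exp u * ((exp (\<alpha> * h) - 1) / (\<alpha> * (1 - exp (- ((3 - \<alpha>) * h))))))
      + real N * \<Lambda>\<^sup>2 * (exp (2 * t * M) - 1 - 2 * t * M)))
    * (\<integral>\<omega>. exp (t * resample_mean (far (R * exp (- D)) - far R) F \<omega>) \<partial>P)"
proof -
  \<comment> \<open>The shells run inwards: shell \<open>i\<close> has outer radius
    \<open>r i\<close> and inner radius \<open>r (Suc i)\<close>, and after \<open>N\<close> steps
    the radius is R exp(-D).\<close>
  define r where "r i = R * exp (- (h * real i))" for i
  define S where "S i = far (r (Suc i)) - far (r i)" for i
  define l where "l i = measure \<nu> (S i)" for i
  define G where "G = exp (2 * t * M) - 1 - 2 * t * M"
  have h: "h > 0" using D N by (simp add: h_def)
  have t: "t > 0" using u lip R by (simp add: t_def)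
  have s: "s \<ge> 0" by (simp add: s_def)
  have M0: "M \<ge> 0" using M[of "{}"] by (auto simp: configurations_def)
  have G: "G \<ge> 0" unfolding G_def by (rule exp_remainder_nonneg)
  have r_pos: "r i > 0" for i using R by (simp add: r_def)
  have r_mono: "i \<le> j \<Longrightarrow> r j \<le> r i" for i j
    using R h by (simp add: r_def)
  have far_mono: "a \<le> b \<Longrightarrow> far b \<subseteq> far a" for a b by (auto simp: far_def)
  have union: "(\<Union>i<n. S i) = far (r n) - far (r 0)" for n
  proof (induction n)
    case (Suc n)
    then show ?case
      using far_mono[OF r_mono[of n "Suc n"]] far_mono[OF r_mono[of 0 n]]
      by (auto simp: lessThan_Suc S_def)
  qed simp
  have rN: "r N = R * exp (- D)" using N by (simp add: r_def h_def)
  have r0: "r 0 = R" by (simp add: r_def)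
  have disj: "disjoint_family_on S {..<N}"
    unfolding disjoint_family_on_def
  proof (intro ballI impI)
    fix i j :: nat assume "i \<noteq> j"
    then consider "Suc i \<le> j" | "Suc j \<le> i" by linarith
    then show "S i \<inter> S j = {}"
      using far_mono[OF r_mono[of "Suc i" j]] far_mono[OF r_mono[of "Suc j" i]]
      by cases (auto simp: S_def)
  qed
  have l_eq: "l i = s / \<alpha> * (exp (\<alpha> * h) - 1) * exp (\<alpha> * h * real i)" for i
  proof -
    have rp: "r i powr - \<alpha> = R powr - \<alpha> * exp (\<alpha> * h * real i)" for i
      using R by (simp add: r_def powr_mult exp_powr_real mult_ac)
    have e: "exp (\<alpha> * h * real (Suc i)) = exp (\<alpha> * h) * exp (\<alpha> * h * real i)"
      by (simp add: exp_add[symmetric] algebra_simps)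
    have "l i = measure \<sigma> (sphere 0 1) / \<alpha> * (r (Suc i) powr - \<alpha> - r i powr - \<alpha>)"
      unfolding l_def S_def by (rule measure_shell[OF r_pos r_mono]) simp
    then show ?thesis
      unfolding rp e by (simp add: s_def right_diff_distrib left_diff_distrib diff_divide_distrib mult_ac)
  qed
  have e1: "exp (\<alpha> * h) - 1 \<ge> 0" using \<alpha> h by simp
  have l0: "l i \<ge> 0" for i by (simp add: l_def)
  have \<Lambda>0: "\<Lambda> \<ge> 0" unfolding \<Lambda>_def using s \<alpha> e1 by simp
  have l_le: "l i \<le> \<Lambda>" if "i < N" for i
  proof -
    have "h * real i \<le> D" using that N D by (simp add: h_def field_simps)
    then have "exp (\<alpha> * h * real i) \<le> exp (\<alpha> * D)" using \<alpha> by (simp add: mult.assoc)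
    then have "s / \<alpha> * (exp (\<alpha> * h) - 1) * exp (\<alpha> * h * real i) \<le> s / \<alpha> * (exp (\<alpha> * h) - 1) * exp (\<alpha> * D)"
      using s \<alpha> e1 by (intro mult_left_mono) auto
    then show ?thesis by (simp add: l_eq \<Lambda>_def mult_ac)
  qed
  have S_fin: "emeasure \<nu> (S i) < \<infinity>" for i
    using emeasure_mono[of "S i" "far (r (Suc i))" \<nu>] emeasure_far_finite[OF r_pos[of "Suc i"]]
    by (auto simp: S_def intro: le_less_trans)
  have "(\<integral>\<omega>. exp (t * F \<omega>) \<partial>P) \<le>
    exp (\<Sum>i<N. exp (2 * t * M * l i) * (l i * (exp (t * (c * r i)) - 1 - t * (c * r i)) + (l i)\<^sup>2 * G))
      * (\<integral>\<omega>. exp (t * resample_mean (\<Union>i<N. S i) F \<omega>) \<partial>P)"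
    unfolding G_def l_def
  proof (rule shells_bound[OF F M lip(1) _ disj])
    show "0 \<notin> S i" for i using r_pos[of "Suc i"] by (auto simp: S_def far_def)
  qed (use lip t r_pos S_fin in \<open>auto simp: S_def far_def intro: less_imp_le\<close>)
  also have "\<dots> \<le> exp (exp (2 * t * M * \<Lambda>) * (s * (u\<^sup>2 / 2 * ((exp (\<alpha> * h) - 1) / (\<alpha> * (1 - exp (- ((2 - \<alpha>) * h)))))
        + exp u * ((exp (\<alpha> * h) - 1) / (\<alpha> * (1 - exp (- ((3 - \<alpha>) * h))))))
      + real N * \<Lambda>\<^sup>2 * G)) * (\<integral>\<omega>. exp (t * resample_mean (\<Union>i<N. S i) F \<omega>) \<partial>P)"
  proof (intro mult_right_mono)
    define q where "q = s / \<alpha> * (exp (\<alpha> * h) - 1)"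
    have q: "q \<ge> 0" using s \<alpha> e1 by (simp add: q_def)
    have summand: "exp (2 * t * M * l i) * (l i * (exp (t * (c * r i)) - 1 - t * (c * r i)) + (l i)\<^sup>2 * G)
       \<le> exp (2 * t * M * \<Lambda>) * (q * (u\<^sup>2 / 2 * exp (- ((2 - \<alpha>) * h * real i)) + exp u * exp (- ((3 - \<alpha>) * h * real i))) + \<Lambda>\<^sup>2 * G)"
      if i: "i < N" for i
    proof (rule mult_mono)
      show "exp (2 * t * M * l i) \<le> exp (2 * t * M * \<Lambda>)"
        using l_le[OF i] t M0 by (simp add: mult_left_mono)
      let ?x = "exp (- (h * real i))"
      have lq: "l i = q * exp (\<alpha> * h * real i)" by (simp add: l_eq q_def)
      \<comment> \<open>The choice t = u/(cR) measures radii relative to \<open>R\<close>, so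
        \<open>?x\<close> lies in (0,1] as \<open>exp_remainder_le\<close> requires.\<close>
      have tc: "t * (c * r i) = u * ?x" using lip R by (simp add: t_def r_def)
      have "l i * (exp (u * ?x) - 1 - u * ?x) \<le> l i * (u\<^sup>2 / 2 * ?x\<^sup>2 + exp u * ?x ^ 3)"
        using u h by (intro mult_left_mono exp_remainder_le l0) auto
      also have "\<dots> = q * (u\<^sup>2 / 2 * (exp (\<alpha> * h * real i) * ?x\<^sup>2) + exp u * (exp (\<alpha> * h * real i) * ?x ^ 3))"
        unfolding lq by (simp only: distrib_left mult_ac)
      also have "exp (\<alpha> * h * real i) * ?x\<^sup>2 = exp (- ((2 - \<alpha>) * h * real i))"
        by (simp add: exp_of_nat_mult[symmetric] exp_add[symmetric] algebra_simps)
      also have "exp (\<alpha> * h * real i) * ?x ^ 3 = exp (- ((3 - \<alpha>) * h * real i))"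
        by (simp add: exp_of_nat_mult[symmetric] exp_add[symmetric] algebra_simps)
      finally have "l i * (exp (u * ?x) - 1 - u * ?x)
        \<le> q * (u\<^sup>2 / 2 * exp (- ((2 - \<alpha>) * h * real i)) + exp u * exp (- ((3 - \<alpha>) * h * real i)))" .
      moreover have "(l i)\<^sup>2 * G \<le> \<Lambda>\<^sup>2 * G"
        using l_le[OF i] l0 G by (intro mult_right_mono power_mono) auto
      ultimately show "l i * (exp (t * (c * r i)) - 1 - t * (c * r i)) + (l i)\<^sup>2 * G
        \<le> q * (u\<^sup>2 / 2 * exp (- ((2 - \<alpha>) * h * real i)) + exp u * exp (- ((3 - \<alpha>) * h * real i))) + \<Lambda>\<^sup>2 * G"
        unfolding tc by linarith
      show "0 \<le> l i * (exp (t * (c * r i)) - 1 - t * (c * r i)) + (l i)\<^sup>2 * G"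
        using l0 G exp_remainder_nonneg by (intro add_nonneg_nonneg mult_nonneg_nonneg) auto
    qed simp
    have gen: "(\<Sum>i<N. E * (p * (A * a i + B * b i) + C)) = E * (p * (A * (\<Sum>i<N. a i) + B * (\<Sum>i<N. b i)) + real N * C)"
      for E p A B C :: real and a b
      by (simp add: sum_distrib_left[symmetric] sum.distrib)
    have "(\<Sum>i<N. exp (2 * t * M * l i) * (l i * (exp (t * (c * r i)) - 1 - t * (c * r i)) + (l i)\<^sup>2 * G))
      \<le> (\<Sum>i<N. exp (2 * t * M * \<Lambda>) * (q * (u\<^sup>2 / 2 * exp (- ((2 - \<alpha>) * h * real i)) + exp u * exp (- ((3 - \<alpha>) * h * real i))) + \<Lambda>\<^sup>2 * G))"
      by (intro sum_mono summand) simp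
    also have "\<dots> = exp (2 * t * M * \<Lambda>) * (q * (u\<^sup>2 / 2 * (\<Sum>i<N. exp (- ((2 - \<alpha>) * h * real i)))
        + exp u * (\<Sum>i<N. exp (- ((3 - \<alpha>) * h * real i)))) + real N * \<Lambda>\<^sup>2 * G)"
      by (subst gen) (simp only: mult.assoc)
    also have "\<dots> \<le> exp (2 * t * M * \<Lambda>) * (q * (u\<^sup>2 / 2 * (1 / (1 - exp (- ((2 - \<alpha>) * h))))
        + exp u * (1 / (1 - exp (- ((3 - \<alpha>) * h))))) + real N * \<Lambda>\<^sup>2 * G)"
      using q \<alpha> h by (intro mult_left_mono add_mono geometric_sum_le order_refl) auto
    also have "q * (u\<^sup>2 / 2 * (1 / (1 - exp (- ((2 - \<alpha>) * h)))) + exp u * (1 / (1 - exp (- ((3 - \<alpha>) * h)))))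
      = s * (u\<^sup>2 / 2 * ((exp (\<alpha> * h) - 1) / (\<alpha> * (1 - exp (- ((2 - \<alpha>) * h)))))
        + exp u * ((exp (\<alpha> * h) - 1) / (\<alpha> * (1 - exp (- ((3 - \<alpha>) * h))))))"
      by (simp add: q_def distrib_left mult_ac)
    finally show "exp (\<Sum>i<N. exp (2 * t * M * l i) * (l i * (exp (t * (c * r i)) - 1 - t * (c * r i)) + (l i)\<^sup>2 * G))
      \<le> exp (exp (2 * t * M * \<Lambda>) * (s * (u\<^sup>2 / 2 * ((exp (\<alpha> * h) - 1) / (\<alpha> * (1 - exp (- ((2 - \<alpha>) * h)))))
        + exp u * ((exp (\<alpha> * h) - 1) / (\<alpha> * (1 - exp (- ((3 - \<alpha>) * h))))))
      + real N * \<Lambda>\<^sup>2 * G))" by simp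
  qed (rule Bochner_Integration.integral_nonneg, simp)
  finally show ?thesis by (simp only: union r0 rN G_def)
qed

end

section \<open>The thin-shell limit\<close>

context stable_process
begin

text \<open>The annulus is fixed while the number n of shells tends to infinity. Then
  \<open>\<Lambda> n\<close> is O(1/n), so n times its square vanishes and with it every trace of
  \<open>M\<close>. The resulting bound does not depend on \<open>D\<close>, which leaves the inner
  radius free to shrink.\<close>

lemma exp_moment_le_annulus:
  assumes F: "F \<in> borel_measurable P" and M: "\<And>\<omega>. \<omega> \<in> configurations \<Longrightarrow> \<bar>F \<omega>\<bar> \<le> M"
    and lip: "lipschitz_difference c F" "c > 0"
    and R: "R > 0" and u: "u > 0" and D: "D > 0"
  defines "s \<equiv> measure \<sigma> (sphere 0 1) * R powr - \<alpha>" and "t \<equiv> u / (c * R)"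
  shows "(\<integral>\<omega>. exp (t * F \<omega>) \<partial>P) \<le> exp (s * (u\<^sup>2 / (2 * (2 - \<alpha>)) + exp u))
    * (\<integral>\<omega>. exp (t * resample_mean (far (R * exp (- D)) - far R) F \<omega>) \<partial>P)"
proof -
  let ?I = "\<integral>\<omega>. exp (t * resample_mean (far (R * exp (- D)) - far R) F \<omega>) \<partial>P"
  define G where "G = exp (2 * t * M) - 1 - 2 * t * M"
  define \<Lambda> where "\<Lambda> n = s / \<alpha> * exp (\<alpha> * D) * (exp (\<alpha> * (D / real n)) - 1)" for n :: nat
  define \<Phi> where "\<Phi> \<gamma> n = (exp (\<alpha> * (D / real n)) - 1) / (\<alpha> * (1 - exp (- (\<gamma> * (D / real n)))))" for \<gamma> and n :: nat
  define K where "K n = exp (2 * t * M * \<Lambda> n) * (s * (u\<^sup>2 / 2 * \<Phi> (2 - \<alpha>) n + exp u * \<Phi> (3 - \<alpha>) n)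
    + real n * (\<Lambda> n)\<^sup>2 * G)" for n
  have le: "(\<integral>\<omega>. exp (t * F \<omega>) \<partial>P) \<le> exp (K n) * ?I" if "n \<ge> 1" for n
    using exp_moment_le_shells[OF F M lip R u D, of n] that
    unfolding K_def \<Phi>_def \<Lambda>_def G_def s_def t_def by simp
  have \<Lambda>0: "\<Lambda> \<longlonglongrightarrow> 0"
    unfolding \<Lambda>_def[abs_def] by real_asymp
  have n\<Lambda>: "(\<lambda>n. real n * (\<Lambda> n)\<^sup>2) \<longlonglongrightarrow> 0"
  proof -
    have "(\<lambda>n. real n * (exp (\<alpha> * (D / real n)) - 1)\<^sup>2) \<longlonglongrightarrow> 0"
      using \<alpha> D by real_asymp
    from tendsto_mult_left[OF this, of "(s / \<alpha> * exp (\<alpha> * D))\<^sup>2"] show ?thesis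
      by (simp add: \<Lambda>_def power_mult_distrib mult_ac power_divide)
  qed
  have \<Phi>: "\<Phi> \<gamma> \<longlonglongrightarrow> 1 / \<gamma>" if "\<gamma> > 0" for \<gamma>
    unfolding \<Phi>_def[abs_def] using \<alpha> that D by (intro geometric_ratio_tendsto)
  have "K \<longlonglongrightarrow> exp (2 * t * M * 0) * (s * (u\<^sup>2 / 2 * (1 / (2 - \<alpha>)) + exp u * (1 / (3 - \<alpha>))) + 0 * G)"
    unfolding K_def[abs_def] using \<alpha> by (intro tendsto_intros \<Lambda>0 n\<Lambda> \<Phi>) auto
  then have "(\<lambda>n. exp (K n) * ?I) \<longlonglongrightarrow> exp (s * (u\<^sup>2 / 2 * (1 / (2 - \<alpha>)) + exp u * (1 / (3 - \<alpha>)))) * ?I"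
    by (intro tendsto_intros) simp
  then have "(\<integral>\<omega>. exp (t * F \<omega>) \<partial>P) \<le> exp (s * (u\<^sup>2 / 2 * (1 / (2 - \<alpha>)) + exp u * (1 / (3 - \<alpha>)))) * ?I"
    by (rule LIMSEQ_le_const) (use le in blast)
  also have "\<dots> \<le> exp (s * (u\<^sup>2 / (2 * (2 - \<alpha>)) + exp u)) * ?I"
  proof (rule mult_right_mono)
    have "exp u * (1 / (3 - \<alpha>)) \<le> exp u * 1" using \<alpha> by (intro mult_left_mono) auto
    then have "u\<^sup>2 / 2 * (1 / (2 - \<alpha>)) + exp u * (1 / (3 - \<alpha>)) \<le> u\<^sup>2 / (2 * (2 - \<alpha>)) + exp u" by simp
    then have "s * (u\<^sup>2 / 2 * (1 / (2 - \<alpha>)) + exp u * (1 / (3 - \<alpha>))) \<le> s * (u\<^sup>2 / (2 * (2 - \<alpha>)) + exp u)"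
      by (rule mult_left_mono) (simp add: s_def)
    then show "exp (s * (u\<^sup>2 / 2 * (1 / (2 - \<alpha>)) + exp u * (1 / (3 - \<alpha>)))) \<le> exp (s * (u\<^sup>2 / (2 * (2 - \<alpha>)) + exp u))"
      by simp
  qed (rule Bochner_Integration.integral_nonneg, simp)
  finally show ?thesis .
qed

text \<open>Since \<open>F\<close> ignores points beyond \<open>R\<close>, resampling an annulus
  with outer radius \<open>R\<close> acts on it like resampling everything off a small ball. This
  matches the annulus bound with the zero-one law.\<close>

lemma exp_moment_le:
  assumes F: "F \<in> borel_measurable P" and M: "\<And>\<omega>. \<omega> \<in> configurations \<Longrightarrow> \<bar>F \<omega>\<bar> \<le> M"
    and lip: "lipschitz_difference c F" "c > 0"
    and R: "R > 0" and u: "u > 0" and det: "\<And>\<omega>. \<omega> \<in> configurations \<Longrightarrow> F \<omega> = F (\<omega> - far R)"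
  defines "s \<equiv> measure \<sigma> (sphere 0 1) * R powr - \<alpha>" and "t \<equiv> u / (c * R)"
  shows "(\<integral>\<omega>. exp (t * F \<omega>) \<partial>P) \<le> exp (s * (u\<^sup>2 / (2 * (2 - \<alpha>)) + exp u)) * exp (t * (\<integral>\<omega>. F \<omega> \<partial>P))"
proof -
  obtain m0 where m0: "inverse (real (Suc m0)) < R" using reals_Archimedean[OF R] by auto
  have t: "t \<ge> 0" using u lip R by (simp add: t_def)
  show ?thesis
  proof (rule exp_moment_limit[OF F M t])
    fix m assume m: "m \<ge> m0"
    define e where "e = inverse (real (Suc m))"
    have e: "0 < e" "e < R"
    proof -
      show "0 < e" by (simp add: e_def)
      have "e \<le> inverse (real (Suc m0))" unfolding e_def using m by (intro le_imp_inverse_le) auto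
      with m0 show "e < R" by linarith
    qed
    \<comment> \<open>Chosen so that the inner radius R exp(-D) is the radius 1/(m+1) that defines
      \<open>off_zero m\<close>.\<close>
    define D where "D = ln (R / e)"
    have D: "D > 0" using e by (simp add: D_def)
    have Re: "R * exp (- D) = e" using e R by (simp add: D_def exp_minus)
    have same: "resample_mean (off_zero m) F \<omega> = resample_mean (far e - far R) F \<omega>"
      if \<omega>: "\<omega> \<in> configurations" for \<omega>
      unfolding resample_mean_def
    proof (rule Bochner_Integration.integral_cong[OF refl])
      fix \<omega>' assume "\<omega>' \<in> space P"
      then have "resample (off_zero m) \<omega> \<omega>' \<in> configurations" "resample (far e - far R) \<omega> \<omega>' \<in> configurations"
        using \<omega> by (auto intro: resample_in_configurations)
      moreover have "resample (off_zero m) \<omega> \<omega>' - far R = resample (far e - far R) \<omega> \<omega>' - far R"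
        by (auto simp: resample_def off_zero_def far_def e_def)
      ultimately show "F (resample (off_zero m) \<omega> \<omega>') = F (resample (far e - far R) \<omega> \<omega>')"
        using det by metis
    qed
    have "(\<integral>\<omega>. exp (t * resample_mean (off_zero m) F \<omega>) \<partial>P) = (\<integral>\<omega>. exp (t * resample_mean (far e - far R) F \<omega>) \<partial>P)"
      by (rule Bochner_Integration.integral_cong) (auto simp: same)
    then show "(\<integral>\<omega>. exp (t * F \<omega>) \<partial>P) \<le> exp (s * (u\<^sup>2 / (2 * (2 - \<alpha>)) + exp u))
        * (\<integral>\<omega>. exp (t * resample_mean (off_zero m) F \<omega>) \<partial>P)"
      using exp_moment_le_annulus[OF F M lip R u D] unfolding Re s_def t_def by simp
  qed
qed

section \<open>Deviations from the mean and from the median\<close>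

lemma deviation_from_mean:
  assumes F: "F \<in> borel_measurable P" and M: "\<And>\<omega>. \<omega> \<in> configurations \<Longrightarrow> \<bar>F \<omega>\<bar> \<le> M"
    and lip: "lipschitz_difference c F" "c > 0"
    and R: "R > 0" and u: "u > 0" and det: "\<And>\<omega>. \<omega> \<in> configurations \<Longrightarrow> F \<omega> = F (\<omega> - far R)"
  shows "prob {\<omega> \<in> configurations. F \<omega> \<ge> (\<integral>\<omega>. F \<omega> \<partial>P) + 2 * c * R}
    \<le> exp (measure \<sigma> (sphere 0 1) * R powr - \<alpha> * (u\<^sup>2 / (2 * (2 - \<alpha>)) + exp u) - 2 * u)"
proof -
  define t where "t = u / (c * R)"
  let ?\<Psi> = "measure \<sigma> (sphere 0 1) * R powr - \<alpha> * (u\<^sup>2 / (2 * (2 - \<alpha>)) + exp u)"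
  let ?a = "(\<integral>\<omega>. F \<omega> \<partial>P) + 2 * c * R"
  have t: "t > 0" using u lip R by (simp add: t_def)
  have "prob {\<omega> \<in> configurations. F \<omega> \<ge> ?a} \<le> exp (- t * ?a) * (\<integral>\<omega>. exp (t * F \<omega>) \<partial>P)"
    by (rule exponential_Markov[OF F M t])
  also have "\<dots> \<le> exp (- t * ?a) * (exp ?\<Psi> * exp (t * (\<integral>\<omega>. F \<omega> \<partial>P)))"
    unfolding t_def by (intro mult_left_mono exp_moment_le[OF F M lip R u det]) auto
  also have "\<dots> = exp (- t * ?a + (?\<Psi> + t * (\<integral>\<omega>. F \<omega> \<partial>P)))" by (simp only: exp_add)
  also have "- t * ?a + (?\<Psi> + t * (\<integral>\<omega>. F \<omega> \<partial>P)) = ?\<Psi> - 2 * u"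
    using lip R by (simp add: t_def field_simps)
  finally show ?thesis .
qed

text \<open>Without mass on the sphere the configuration is almost surely empty, so \<open>F\<close>
  is almost surely the constant \<open>F {}\<close>, which cannot exceed a median.\<close>

lemma prob_median_tail_trivial:
  assumes s0: "measure \<sigma> (sphere 0 1) = 0" and F: "F \<in> borel_measurable P"
    and med: "is_median P F m" and x: "x > 0"
  shows "prob {\<omega> \<in> space P. F \<omega> - m \<ge> x} = 0"
proof -
  have "AE \<omega> in P. \<omega> \<inter> far (inverse (real (Suc n))) = {}" for n
    by (rule AE_no_points) (auto simp: emeasure_far s0 simp del: of_nat_Suc)
  then have "AE \<omega> in P. \<forall>n. \<omega> \<inter> far (inverse (real (Suc n))) = {}"
    by (simp add: AE_all_countable)
  then have empty: "AE \<omega> in P. \<omega> = {}"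
    using AE_space
  proof eventually_elim
    case (elim \<omega>)
    show ?case
    proof (rule ccontr)
      assume "\<omega> \<noteq> {}"
      then obtain y where y: "y \<in> \<omega>" by auto
      with elim(2) have "y \<noteq> 0" by (auto simp: configurations_def)
      then obtain n where "inverse (real (Suc n)) < norm y" using reals_Archimedean[of "norm y"] by auto
      with elim(1) y show False by (auto simp: far_def)
    qed
  qed
  note F[measurable]
  have "F {} \<le> m"
  proof (rule ccontr)
    assume "\<not> ?thesis"
    then have "AE \<omega> in P. \<not> F \<omega> \<le> m" using empty by auto
    then have "prob {\<omega> \<in> space P. F \<omega> \<le> m} = 0" by (subst prob_Collect_eq_0) measurable
    then show False using med by (simp add: is_median_def)
  qed
  then have "AE \<omega> in P. \<not> F \<omega> - m \<ge> x" using empty x by auto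
  then show ?thesis by (subst prob_Collect_eq_0) measurable
qed

text \<open>The event F \<ge> m + x is covered by the presence of a point beyond \<open>R\<close>
  and an upward deviation of the truncated functional by 2cR from its mean. The two costs s/\<alpha>
  and 3e^2 s/2 are the two summands of the bound.\<close>

lemma median_tail:
  assumes F: "F \<in> borel_measurable P" and lip: "lipschitz_difference c F" "c > 0"
    and med: "is_median P F m" and x: "x > 0"
    and s0: "measure \<sigma> (sphere 0 1) > 0"
  defines "s \<equiv> measure \<sigma> (sphere 0 1) * (x / (4 * c)) powr - \<alpha>"
  assumes K: "3 / 2 * (1 + 4 / (2 - \<alpha>) * ln (2 / (2 - \<alpha>))) * ln (1 + 8 / (2 - \<alpha>) * ln (2 / (2 - \<alpha>))) \<le> 1 / s"
      "4 / \<alpha> \<le> 1 / s" "6 * (exp 1)\<^sup>2 \<le> 1 / s"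
  shows "prob {\<omega> \<in> space P. F \<omega> - m \<ge> x} \<le> s * (3 / 2 * (exp 1)\<^sup>2 + 1 / \<alpha>)"
proof -
  define R where "R = x / (4 * c)"
  define d where "d = 3 / 2 * (exp 1)\<^sup>2 * s"
  \<comment> \<open>The clamping levels m - x and m + x preserve the only two events that matter: F
    \<le> m gives G \<le> m, and F \<ge> m + x gives G \<ge> m + x.\<close>
  define G where "G = (\<lambda>\<omega>. max (m - x) (min (m + x) (F \<omega>)))"
  define H where "H = (\<lambda>\<omega>. G (\<omega> - far R))"
  define M where "M = \<bar>m\<bar> + x"
  have R: "R > 0" using x lip by (simp add: R_def)
  have xR: "x = 4 * c * R" using lip by (simp add: R_def)
  have s: "s > 0" using s0 x lip by (simp add: s_def)
  have sR: "measure \<sigma> (sphere 0 1) * R powr - \<alpha> = s" by (simp add: s_def R_def)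
  \<comment> \<open>The term 6e^2 of the maximum gives both d \<le> 1/4 and s < 1, so that -ln s is
    an admissible positive parameter; the term 4/\<alpha> gives s/\<alpha> \<le> 1/4.\<close>
  have s_le: "s \<le> 1 / (6 * (exp 1)\<^sup>2)" using K(3) s by (simp add: field_simps)
  then have d_le: "d \<le> 1 / 4" by (simp add: d_def field_simps)
  have "1 \<le> (exp 1 :: real)\<^sup>2" by (rule one_le_power) simp
  then have "1 < 1 / s" using K(3) by linarith
  then have s1: "s < 1" using s by simp
  have sa: "s / \<alpha> \<le> 1 / 4" using K(2) s \<alpha> by (simp add: field_simps)
  note F[measurable]
  have G: "G \<in> borel_measurable P" unfolding G_def by measurable
  have H[measurable]: "H \<in> borel_measurable P"
    unfolding H_def by (rule measurable_compose[OF measurable_Diff[OF far_borel] G])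
  have M: "\<bar>H \<omega>\<bar> \<le> M" for \<omega> using x by (auto simp: H_def G_def M_def)
  have lipG: "lipschitz_difference c G"
    unfolding G_def by (rule lipschitz_difference_clamp[OF lip(1)])
  have lipH: "lipschitz_difference c H"
    unfolding H_def using lip(2)
    by (intro lipschitz_difference_restrict[OF lipG far_borel emeasure_far_finite[OF R]]) simp
  have u: "- ln s > 0" using s s1 by simp
  have det: "H \<omega> = H (\<omega> - far R)" for \<omega> by (simp add: H_def)
  \<comment> \<open>Stated for a general \<open>f\<close> because it is used for \<open>H\<close> in
    the upper tail and for \<open>- H\<close> in locating the mean.\<close>
  have dev: "prob {\<omega> \<in> configurations. f \<omega> \<ge> (\<integral>\<omega>. f \<omega> \<partial>P) + 2 * c * R} \<le> d"
    if "f \<in> borel_measurable P" "\<And>\<omega>. \<bar>f \<omega>\<bar> \<le> M" "lipschitz_difference c f" "\<And>\<omega>. f \<omega> = f (\<omega> - far R)" for f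
  proof -
    have "prob {\<omega> \<in> configurations. f \<omega> \<ge> (\<integral>\<omega>. f \<omega> \<partial>P) + 2 * c * R}
      \<le> exp (s * ((- ln s)\<^sup>2 / (2 * (2 - \<alpha>)) + exp (- ln s)) - 2 * - ln s)"
      unfolding sR[symmetric] by (rule deviation_from_mean[OF that(1,2,3) lip(2) R _ that(4)]) (use u sR in simp)
    also have "\<dots> \<le> d" unfolding d_def by (rule deviation_bound_le[OF \<alpha> s s1 K(1)])
    finally show ?thesis .
  qed
  let ?e = "\<integral>\<omega>. H \<omega> \<partial>P"
  define A where "A = {\<omega> \<in> configurations. \<omega> \<inter> far R \<noteq> {}}"
  have A_eq: "A = space P - {\<omega> \<in> configurations. \<omega> \<inter> far R = {}}" by (auto simp: A_def)
  have A: "A \<in> sets P" unfolding A_eq by (intro sets.Diff sets.top sets_no_points far_borel)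
  have pA: "prob A = 1 - exp (- (s / \<alpha>))"
    unfolding A_eq prob_compl[OF sets_no_points[OF far_borel]]
      prob_no_points[OF far_borel emeasure_far_finite[OF R]] measure_far[OF R] sR ..
  have FH: "H \<omega> = G \<omega>" if "\<omega> \<in> configurations" "\<omega> \<notin> A" for \<omega>
  proof -
    have "\<omega> - far R = \<omega>" using that by (auto simp: A_def)
    then show ?thesis by (simp add: H_def)
  qed
  have up: "{\<omega> \<in> configurations. H \<omega> \<ge> ?e + 2 * c * R} \<in> sets P"
  proof -
    have "{\<omega> \<in> space P. H \<omega> \<ge> ?e + 2 * c * R} \<in> sets P" by measurable
    then show ?thesis by simp
  qed
  have down: "{\<omega> \<in> configurations. - H \<omega> \<ge> (\<integral>\<omega>. - H \<omega> \<partial>P) + 2 * c * R} \<in> sets P"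
  proof -
    have "{\<omega> \<in> space P. - H \<omega> \<ge> (\<integral>\<omega>. - H \<omega> \<partial>P) + 2 * c * R} \<in> sets P" by measurable
    then show ?thesis by simp
  qed
  \<comment> \<open>If the mean were larger, every configuration with F \<le> m would either have a
    point beyond \<open>R\<close> or make \<open>- H\<close> exceed its mean by 2cR. That has
    probability below s/\<alpha> + d \<le> 1/2, contradicting the median. The strictness comes from
    1 - exp(-v) < v for v > 0.\<close>
  have mean: "?e \<le> m + 2 * c * R"
  proof (rule ccontr)
    assume contra: "\<not> ?thesis"
    have "1 / 2 \<le> prob {\<omega> \<in> space P. F \<omega> \<le> m}" using med by (simp add: is_median_def)
    also have "\<dots> \<le> prob (A \<union> {\<omega> \<in> configurations. - H \<omega> \<ge> (\<integral>\<omega>. - H \<omega> \<partial>P) + 2 * c * R})"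
    proof (rule finite_measure_mono)
      show "{\<omega> \<in> space P. F \<omega> \<le> m} \<subseteq> A \<union> {\<omega> \<in> configurations. - H \<omega> \<ge> (\<integral>\<omega>. - H \<omega> \<partial>P) + 2 * c * R}"
      proof
        fix \<omega> assume \<omega>: "\<omega> \<in> {\<omega> \<in> space P. F \<omega> \<le> m}"
        show "\<omega> \<in> A \<union> {\<omega> \<in> configurations. - H \<omega> \<ge> (\<integral>\<omega>. - H \<omega> \<partial>P) + 2 * c * R}"
        proof (cases "\<omega> \<in> A")
          case False
          have "G \<omega> \<le> m" using \<omega> x by (auto simp: G_def)
          then have "H \<omega> \<le> m" using FH[of \<omega>] False \<omega> by simp
          then show ?thesis using contra \<omega> by simp
        qed simp
      qed
    qed (intro sets.Un A down)
    also have "\<dots> \<le> prob A + prob {\<omega> \<in> configurations. - H \<omega> \<ge> (\<integral>\<omega>. - H \<omega> \<partial>P) + 2 * c * R}"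
      by (rule measure_Un_le[OF A down])
    also have "\<dots> \<le> prob A + d"
    proof -
      have "(\<lambda>\<omega>. - H \<omega>) \<in> borel_measurable P" by measurable
      from dev[OF this _ lipschitz_difference_uminus[OF lipH]] show ?thesis
        using M det by simp
    qed
    also have "\<dots> < s / \<alpha> + d"
      using pA exp_minus_greater[of "s / \<alpha>"] s \<alpha> by simp
    finally show False using sa d_le by simp
  qed
  have "prob {\<omega> \<in> space P. F \<omega> - m \<ge> x} \<le> prob (A \<union> {\<omega> \<in> configurations. H \<omega> \<ge> ?e + 2 * c * R})"
  proof (rule finite_measure_mono)
    show "{\<omega> \<in> space P. F \<omega> - m \<ge> x} \<subseteq> A \<union> {\<omega> \<in> configurations. H \<omega> \<ge> ?e + 2 * c * R}"
    proof
      fix \<omega> assume \<omega>: "\<omega> \<in> {\<omega> \<in> space P. F \<omega> - m \<ge> x}"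
      show "\<omega> \<in> A \<union> {\<omega> \<in> configurations. H \<omega> \<ge> ?e + 2 * c * R}"
      proof (cases "\<omega> \<in> A")
        case False
        have "G \<omega> \<ge> m + x" using \<omega> x by (auto simp: G_def)
        then have "H \<omega> \<ge> m + x" using FH[of \<omega>] False \<omega> by simp
        then show ?thesis using mean \<omega> xR by simp
      qed simp
    qed
  qed (intro sets.Un A up)
  also have "\<dots> \<le> prob A + prob {\<omega> \<in> configurations. H \<omega> \<ge> ?e + 2 * c * R}"
    by (rule measure_Un_le[OF A up])
  also have "\<dots> \<le> s / \<alpha> + d"
    using dev[OF H M lipH det] pA exp_ge_add_one_self[of "- (s / \<alpha>)"] by simp
  finally show ?thesis by (simp add: d_def algebra_simps)
qed

end

theorem theorem6p1:
  fixes \<alpha> c m x :: real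
    and \<sigma> :: "(real ^ 'n) measure"
    and P :: "(real ^ 'n) set measure"
    and F :: "(real ^ 'n) set \<Rightarrow> real"
  assumes "0 < \<alpha>" and "\<alpha> < 2"
    and "finite_measure \<sigma>"
    and "sets \<sigma> = sets (restrict_space borel (sphere 0 1))"
    and "poisson_measure (stable_levy_measure \<alpha> \<sigma>) P"
    and "F \<in> borel_measurable P"
    and "c > 0"
    and "AE (\<omega>, y) in P \<Otimes>\<^sub>M stable_levy_measure \<alpha> \<sigma>. \<bar>difference y F \<omega>\<bar> \<le> c * norm y"
    and "is_median P F m"
    and "x > 0"
    and "x \<ge> 4 * c * measure \<sigma> (sphere 0 1) powr (1 / \<alpha>) *
           (max (max (3 / 2 * (1 + 4 / (2 - \<alpha>) * ln (2 / (2 - \<alpha>)))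
                        * ln (1 + 8 / (2 - \<alpha>) * ln (2 / (2 - \<alpha>))))
                     (4 / \<alpha>))
                (6 * (exp 1)\<^sup>2)) powr (1 / \<alpha>)"
  shows "measure P {\<omega> \<in> space P. F \<omega> - m \<ge> x}
           \<le> measure \<sigma> (sphere 0 1) * (3 / 2 * (exp 1)\<^sup>2 + 1 / \<alpha>) * ((4 * c) powr \<alpha> / x powr \<alpha>)"
proof -
  interpret stable_process \<alpha> \<sigma> P
    using assms(1-5) by (rule stable_process.intro)
  let ?s0 = "measure \<sigma> (sphere 0 1)"
  define K where "K = max (max (3 / 2 * (1 + 4 / (2 - \<alpha>) * ln (2 / (2 - \<alpha>)))
                        * ln (1 + 8 / (2 - \<alpha>) * ln (2 / (2 - \<alpha>)))) (4 / \<alpha>)) (6 * (exp 1)\<^sup>2)"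
  define s where "s = ?s0 * (x / (4 * c)) powr - \<alpha>"
  have s_eq: "s = ?s0 * ((4 * c) powr \<alpha> / x powr \<alpha>)"
    using assms(7,10) by (simp add: s_def powr_minus powr_divide)
  show ?thesis
  \<comment> \<open>With zero spherical mass the lower bound on \<open>x\<close> degenerates to 0
    and s = 0, so the condition K \<le> 1/s carries no meaning and the case is settled
    separately.\<close>
  proof (cases "?s0 = 0")
    case True
    then show ?thesis using prob_median_tail_trivial[OF True assms(6,9,10)] by simp
  next
    case False
    then have s0: "?s0 > 0" using measure_nonneg[of \<sigma> "sphere 0 1"] by linarith
    have K0: "K > 0" unfolding K_def by (rule less_le_trans[OF _ max.cobounded2]) simp
    have "4 * c * ?s0 powr (1 / \<alpha>) * K powr (1 / \<alpha>) \<le> x"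
      unfolding K_def by (rule assms(11))
    then have "(?s0 * K) powr (1 / \<alpha>) \<le> x / (4 * c)"
      using assms(7) s0 K0 by (simp add: powr_mult field_simps)
    \<comment> \<open>Raising to the power \<alpha> turns the lower bound on \<open>x\<close> into K
      \<le> 1/s, from which the three conditions on 1/s in \<open>median_tail\<close> are read
      off.\<close>
    then have "((?s0 * K) powr (1 / \<alpha>)) powr \<alpha> \<le> (x / (4 * c)) powr \<alpha>"
      using assms(1) by (intro powr_mono2) auto
    moreover have "((?s0 * K) powr (1 / \<alpha>)) powr \<alpha> = ?s0 * K"
      unfolding powr_powr using assms(1) s0 K0 by simp
    moreover have "1 / s = (x / (4 * c)) powr \<alpha> / ?s0"
      unfolding s_def powr_minus by (simp add: field_simps)
    ultimately have "K \<le> 1 / s" using s0 by (simp add: pos_le_divide_eq mult.commute)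
    then have "prob {\<omega> \<in> space P. F \<omega> - m \<ge> x} \<le> s * (3 / 2 * (exp 1)\<^sup>2 + 1 / \<alpha>)"
      unfolding s_def
      by (intro median_tail[OF assms(6) lipschitz_differenceI[OF assms(6,8)] assms(7,9,10) s0])
        (simp_all add: K_def)
    then show ?thesis by (simp add: s_eq mult_ac)
  qed
qed

end
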